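(* Let $r>0$. (i) For any $R>0$ and any measurable set $E\subseteq\mathbb{R}^n$ such that $\mathcal{L}^n(E)=\mathcal{L}^n(B_R)$ it holds that $$\mathrm{Per}_r(E)\ge\mathrm{Per}_r(B_R).$$ (ii) Vice versa, if $\mathcal{L}^n(E)=\mathcal{L}^n(B_R)$ and $\mathrm{Per}_r(E)=\mathrm{Per}_r(B_R)$, then $E=B_R(p)\setminus\mathcal{N}$ for some set $\mathcal{N}$ of null measure and some $p\in\mathbb{R}^n$.
   Context: $B_\rho(x)$ is the ball of radius $\rho$ centered at $x$ in $\mathbb{R}^n$, $B_\rho:=B_\rho(0)$, and $\mathcal{L}^n$ is the $n$-dimensional Lebesgue measure. For $A\subseteq\mathbb{R}^n$, $A\oplus B_r:=\bigcup_{x\in A}B_r(x)$. Measurable sets are identified with their sets of points of density one (so equalities of sets are up to null sets), and $\partial E$ denotes the topological boundary of the set of points of density one of $E$. For measurable $E\subseteq\mathbb{R}^n$, $$\mathrm{Per}_r(E):=\frac{1}{2r}\mathcal{L}^n\big((\partial E)\oplus B_r\big).$$ *)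

theory Defs
  imports "HOL-Analysis.Analysis"
begin

definition density_one_points :: "(real^'n) set \<Rightarrow> (real^'n) set" where
  "density_one_points E =
     {x. ((\<lambda>\<rho>. measure lebesgue (E \<inter> ball x \<rho>) / measure lebesgue (ball x \<rho>)) \<longlongrightarrow> 1)
           (at_right 0)}"

definition ball_enlargement :: "(real^'n) set \<Rightarrow> real \<Rightarrow> (real^'n) set" where
  "ball_enlargement A r = (\<Union>x\<in>A. ball x r)"

(* The boundary is that of the canonical representative of the class of E modulo null sets,
   so Per r E does not change when E is modified on a null set.
   The value is infinite when the enlarged boundary has infinite measure. *)
definition Per :: "real \<Rightarrow> (real^'n) set \<Rightarrow> ennreal" where
  "Per r E = ennreal (1 / (2 * r)) *
     emeasure lebesgue (ball_enlargement (frontier (density_one_points E)) r)"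

definition ae_eq_set :: "(real^'n) set \<Rightarrow> (real^'n) set \<Rightarrow> bool" where
  "ae_eq_set E F \<longleftrightarrow> sym_diff E F \<in> null_sets lebesgue"

end

theory Submission
  imports Defs "HOL-Probability.Distribution_Functions"
begin

text \<open>
  Let \<open>F\<close> be the set of density-one points of \<open>E\<close>; by the Lebesgue density theorem it agrees with
  \<open>E\<close> up to a null set. A ball of radius \<open>r\<close> meets the frontier of \<open>F\<close> exactly when it meets both
  \<open>F\<close> and its complement, because balls are connected. Hence the \<open>r\<close>-enlargement of the frontier is
  the outer parallel set \<open>F + ball 0 r\<close> minus the inner parallel set \<open>{x. ball x r \<subseteq> F}\<close>
  (\<open>frontier_enlargement\<close>). The Brunn-Minkowski inequality bounds the volume of the outer parallel set
  from below by that of \<open>ball 0 (R + r)\<close>; applied to the inner parallel set, whose sum with \<open>ball 0 r\<close>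
  lies in \<open>F\<close>, it bounds the volume of that set from above by the corresponding volume for
  \<open>ball 0 R\<close>. The difference of the two bounds is the value for the ball, which is part (i).
  The Brunn-Minkowski inequality itself is proved by the argument of Hadwiger and Ohmann: it holds for
  boxes by the inequality of arithmetic and geometric means, passes to finite unions of boxes by cutting
  both sets by parallel hyperplanes in the same proportion, and then to all sets by approximation.

  For part (ii), equality forces the outer parallel set to have the volume of \<open>ball 0 (R + r)\<close>, so
  equality holds in the Brunn-Minkowski inequality for \<open>F\<close> and a ball. Fix a unit vector \<open>e\<close> and
  consider the parts of \<open>F\<close>, of \<open>B = ball 0 r\<close> and of \<open>F + B\<close> on one side of a hyperplane orthogonal to
  \<open>e\<close>. If hyperplanes cut \<open>F\<close> and \<open>B\<close> in the same proportion, then the inequality for the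
  lower and for the upper parts adds up to the equality for the whole, so the cut of \<open>F + B\<close> at the
  sum of the heights has that same proportion. For different proportions one still has an inequality.
  In terms of the heights \<open>f x\<close> and \<open>g x\<close> below which \<open>F\<close> and \<open>B\<close> have the fraction \<open>x ^ n\<close> of their
  volume, where \<open>n\<close> is the dimension, these two facts say that
  \<open>f m + g m \<le> f x + g y\<close>, where \<open>m\<close> is the mean of \<open>x\<close> and \<open>y\<close> with weights \<open>R\<close> and \<open>r\<close>. This
  forces \<open>f\<close> to be \<open>(R / r) * g\<close> plus a constant (\<open>balanced_quantiles\<close>): along each direction \<open>e\<close>,
  the volume of \<open>F\<close> is distributed over the heights like that of a ball of radius \<open>R\<close> with centre \<open>k e *\<^sub>R e\<close>.
  Comparing mean heights shows that \<open>k e\<close> is the inner product of \<open>e\<close> with the centroid \<open>p\<close> of \<open>F\<close>.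
  So, up to null sets, \<open>F\<close> lies in every slab of half-width \<open>R\<close> around \<open>p\<close>, hence in
  \<open>cball p R\<close>, and it has the same volume.
\<close>

section \<open>Distribution of volume over heights\<close>

text \<open>
  The push-forward of Lebesgue measure on \<open>S\<close> under \<open>x \<mapsto> x \<bullet> e\<close>. Seeing \<open>volume_below\<close> as its
  cumulative distribution function gives continuity, limits and uniqueness from the general theory of
  such functions.
\<close>
definition height_measure :: "'a::euclidean_space set \<Rightarrow> 'a \<Rightarrow> real measure" where
  "height_measure S e = distr (restrict_space lebesgue S) borel (\<lambda>x. x \<bullet> e)"

definition volume_below :: "'a::euclidean_space set \<Rightarrow> 'a \<Rightarrow> real \<Rightarrow> real" where
  "volume_below S e s = measure lebesgue (S \<inter> {x. x \<bullet> e \<le> s})"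

lemma closed_halfspace: "closed {x::'a::euclidean_space. x \<bullet> e \<le> s}"
  using closed_halfspace_le[of e s] by (simp add: inner_commute)

lemma lmeasurable_below [simp]: "S \<in> lmeasurable \<Longrightarrow> S \<inter> {x. x \<bullet> e \<le> s} \<in> lmeasurable"
  by (intro fmeasurable_Int_fmeasurable) (auto intro: closed_halfspace)

lemma measurable_height: "(\<lambda>x. x \<bullet> e) \<in> measurable (restrict_space lebesgue S) borel"
  by (intro measurable_restrict_space1 measurable_completion) auto

lemma
  assumes S: "S \<in> lmeasurable"
  shows finite_borel_height_measure: "finite_borel_measure (height_measure S e)"
    and measure_height_measure:
      "X \<in> sets borel \<Longrightarrow> measure (height_measure S e) X = measure lebesgue (S \<inter> {x. x \<bullet> e \<in> X})"
    and cdf_height_measure: "cdf (height_measure S e) = volume_below S e"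
proof -
  have [simp]: "S \<in> sets lebesgue" using S by auto
  show *: "measure (height_measure S e) X = measure lebesgue (S \<inter> {x. x \<bullet> e \<in> X})" if "X \<in> sets borel" for X
    unfolding height_measure_def using that
    by (subst measure_distr[OF measurable_height])
       (auto simp: measure_restrict_space space_restrict_space Int_def vimage_def conj_commute)
  show "cdf (height_measure S e) = volume_below S e"
    unfolding cdf_def volume_below_def by (subst *) auto
  have "finite_measure (restrict_space lebesgue S)"
    using S by (intro finite_measureI) (auto simp: emeasure_restrict_space space_restrict_space fmeasurable_def)
  then interpret finite_measure "height_measure S e"
    unfolding height_measure_def by (rule finite_measure.finite_measure_distr) (rule measurable_height)
  show "finite_borel_measure (height_measure S e)"
    by unfold_locales (auto simp: height_measure_def)
qed

lemma negligible_level: "e \<noteq> 0 \<Longrightarrow> negligible {x::'a::euclidean_space. x \<bullet> e = s}"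
  using negligible_hyperplane[of e s] by (simp add: inner_commute)

lemma continuous_volume_below:
  assumes S: "S \<in> lmeasurable" and e: "e \<noteq> 0"
  shows "isCont (volume_below S e) s"
proof -
  interpret finite_borel_measure "height_measure S e" by (rule finite_borel_height_measure[OF S])
  have "measure lebesgue (S \<inter> {x. x \<bullet> e = s}) = 0"
    by (rule negligible_imp_measure0, rule negligible_subset[OF negligible_level[OF e, of s]]) auto
  then show ?thesis
    using isCont_cdf[of s] by (simp add: cdf_height_measure[OF S] measure_height_measure[OF S])
qed

lemma volume_below_mono: "S \<in> lmeasurable \<Longrightarrow> s \<le> t \<Longrightarrow> volume_below S e s \<le> volume_below S e t"
  unfolding volume_below_def by (intro measure_mono_fmeasurable) auto

lemma volume_below_nonneg: "0 \<le> volume_below S e s"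
  by (simp add: volume_below_def)

lemma volume_below_le: "S \<in> lmeasurable \<Longrightarrow> volume_below S e s \<le> measure lebesgue S"
  unfolding volume_below_def by (intro measure_mono_fmeasurable) auto

lemma volume_above:
  assumes S: "S \<in> lmeasurable"
  shows "S \<inter> {x. s < x \<bullet> e} \<in> lmeasurable"
    and "measure lebesgue (S \<inter> {x. s < x \<bullet> e}) = measure lebesgue S - volume_below S e s"
proof -
  have eq: "S \<inter> {x. s < x \<bullet> e} = S - (S \<inter> {x. x \<bullet> e \<le> s})" by auto
  show "S \<inter> {x. s < x \<bullet> e} \<in> lmeasurable" unfolding eq by (intro fmeasurable.Diff) (auto simp: S)
  show "measure lebesgue (S \<inter> {x. s < x \<bullet> e}) = measure lebesgue S - volume_below S e s"
    unfolding eq volume_below_def by (rule measurable_measure_Diff) (use S in auto)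
qed

lemma volume_strictly_below:
  assumes S: "S \<in> lmeasurable" and "e \<noteq> 0"
  shows "S \<inter> {x. x \<bullet> e < s} \<in> lmeasurable"
    and "measure lebesgue (S \<inter> {x. x \<bullet> e < s}) = volume_below S e s"
proof -
  have eq: "S \<inter> {x. x \<bullet> e < s} = (S \<inter> {x. x \<bullet> e \<le> s}) - {x. x \<bullet> e = s}" by auto
  have null: "{x. x \<bullet> e = s} \<in> null_sets lebesgue"
    using negligible_level[OF \<open>e \<noteq> 0\<close>] by (simp add: negligible_iff_null_sets)
  then show "S \<inter> {x. x \<bullet> e < s} \<in> lmeasurable" 
    unfolding eq by (intro fmeasurable_Diff) (auto simp: S)
  show "measure lebesgue (S \<inter> {x. x \<bullet> e < s}) = volume_below S e s"
    unfolding eq volume_below_def using null S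
    by (intro measure_Diff_null_set) auto
qed

lemma volume_below_IVT:
  assumes S: "S \<in> lmeasurable" and e: "e \<noteq> 0" and v: "0 < v" "v < measure lebesgue S"
  obtains s where "volume_below S e s = v"
proof -
  interpret finite_borel_measure "height_measure S e" by (rule finite_borel_height_measure[OF S])
  have sp: "measure (height_measure S e) (space (height_measure S e)) = measure lebesgue S"
    using measure_height_measure[OF S, of UNIV e] by (simp add: height_measure_def)
  have "\<forall>\<^sub>F s in at_top. v < volume_below S e s"
    using cdf_lim_at_top v(2) unfolding sp cdf_height_measure[OF S] by (rule order_tendstoD)
  then obtain t where t: "v < volume_below S e t" by (auto simp: eventually_at_top_linorder)
  have "\<forall>\<^sub>F s in at_bot. volume_below S e s < v"
    using cdf_lim_at_bot v(1) unfolding cdf_height_measure[OF S] by (rule order_tendstoD)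
  then obtain u where u: "volume_below S e u < v" by (auto simp: eventually_at_bot_linorder)
  have "u \<le> t" using t u volume_below_mono[OF S, of t u e] by linarith
  then have "\<exists>s\<ge>u. s \<le> t \<and> volume_below S e s = v"
    using t u continuous_volume_below[OF S e] by (intro IVT) auto
  then show ?thesis using that by blast
qed

section \<open>The Brunn-Minkowski inequality for unions of boxes\<close>

text \<open>
  Dividing by the right-hand side, this is the inequality of arithmetic and geometric means for the
  ratios \<open>a i / (a i + b i)\<close> and for the ratios \<open>b i / (a i + b i)\<close>: the two arithmetic means add up to 1.
\<close>
lemma root_prod_superadditive:
  fixes a b :: "'i \<Rightarrow> real"
  assumes I: "finite I" "I \<noteq> {}" and pos: "\<And>i. i \<in> I \<Longrightarrow> 0 < a i" "\<And>i. i \<in> I \<Longrightarrow> 0 < b i"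
  shows "root (card I) (\<Prod>i\<in>I. a i) + root (card I) (\<Prod>i\<in>I. b i) \<le> root (card I) (\<Prod>i\<in>I. a i + b i)"
proof -
  define n where "n = card I"
  have n: "n > 0" using I by (auto simp: n_def card_gt_0_iff)
  have key: "root n (\<Prod>i\<in>I. f i) \<le> (\<Sum>i\<in>I. f i / (a i + b i)) / n * root n (\<Prod>i\<in>I. a i + b i)"
    if f: "\<And>i. i \<in> I \<Longrightarrow> 0 < f i" for f
  proof -
    have "root n (\<Prod>i\<in>I. f i / (a i + b i)) = (\<Prod>i\<in>I. f i / (a i + b i)) powr (1 / n)"
      using n pos f by (simp add: root_powr_inverse less_imp_le[OF prod_pos] add_pos_pos less_imp_le)
    also have "\<dots> \<le> (\<Sum>i\<in>I. f i / (a i + b i) / n)"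
      unfolding n_def using I pos f 
      by (intro arith_geom_mean) (auto simp: add_pos_pos less_imp_le)
    finally have *: "root n (\<Prod>i\<in>I. f i / (a i + b i)) \<le> (\<Sum>i\<in>I. f i / (a i + b i)) / n"
      by (simp add: sum_divide_distrib)
    have "(\<Prod>i\<in>I. f i) = (\<Prod>i\<in>I. f i / (a i + b i)) * (\<Prod>i\<in>I. a i + b i)"
      using pos by (subst prod.distrib[symmetric]) (intro prod.cong, auto simp: add_pos_pos less_imp_neq[symmetric])
    then have "root n (\<Prod>i\<in>I. f i) = root n (\<Prod>i\<in>I. f i / (a i + b i)) * root n (\<Prod>i\<in>I. a i + b i)"
      using n by (simp add: real_root_mult)
    also have "\<dots> \<le> (\<Sum>i\<in>I. f i / (a i + b i)) / n * root n (\<Prod>i\<in>I. a i + b i)"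
      using n pos by (intro mult_right_mono * real_root_ge_zero prod_nonneg) (auto simp: add_pos_pos less_imp_le)
    finally show ?thesis .
  qed
  have "(\<Sum>i\<in>I. a i / (a i + b i)) + (\<Sum>i\<in>I. b i / (a i + b i)) = (\<Sum>i\<in>I. 1)"
    unfolding sum.distrib[symmetric] add_divide_distrib[symmetric]
    by (rule sum.cong) (use pos in \<open>auto simp: add_pos_pos less_imp_neq[symmetric]\<close>)
  then have one: "(\<Sum>i\<in>I. a i / (a i + b i)) / n + (\<Sum>i\<in>I. b i / (a i + b i)) / n = 1"
    unfolding add_divide_distrib[symmetric] using n by (simp add: n_def)
  have "root n (\<Prod>i\<in>I. a i) + root n (\<Prod>i\<in>I. b i)
      \<le> (\<Sum>i\<in>I. a i / (a i + b i)) / n * root n (\<Prod>i\<in>I. a i + b i)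
        + (\<Sum>i\<in>I. b i / (a i + b i)) / n * root n (\<Prod>i\<in>I. a i + b i)"
    using key[of a] key[of b] pos by auto
  also have "\<dots> = root n (\<Prod>i\<in>I. a i + b i)"
    unfolding distrib_right[symmetric] one by simp
  finally show ?thesis by (simp add: n_def)
qed

lemma open_set_plus: "open (B::'a::real_normed_vector set) \<Longrightarrow> open (A + B)"
proof -
  assume "open B"
  then have "open (\<Union>a\<in>A. (+) a ` B)" by (auto intro: open_translation)
  also have "(\<Union>a\<in>A. (+) a ` B) = A + B" by (auto simp: set_plus_def)
  finally show ?thesis .
qed

lemma bounded_set_plus: "bounded A \<Longrightarrow> bounded B \<Longrightarrow> bounded (A + B :: 'a::real_normed_vector set)"
  proof -
  assume "bounded A" "bounded B"
  then have "bounded (\<Union>x\<in>A. \<Union>y\<in>B. {x + y})" by (rule bounded_sums)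
  also have "(\<Union>x\<in>A. \<Union>y\<in>B. {x + y}) = A + B" by (auto simp: set_plus_def)
  finally show ?thesis .
qed

text \<open>
  A point of the large box sits at a fraction \<open>t i\<close> of the \<open>i\<close>-th edge; it is the sum of the points of the
  two summands at the same fractions.
\<close>
lemma box_subset_plus:
  fixes a b c d :: "'a::euclidean_space"
  assumes "box a b \<noteq> {}" "box c d \<noteq> {}"
  shows "box (a + c) (b + d) \<subseteq> box a b + box c d"
proof
  fix x assume x: "x \<in> box (a + c) (b + d)"
  have ab: "a \<bullet> i < b \<bullet> i" "c \<bullet> i < d \<bullet> i" if "i \<in> Basis" for i
    using assms that by (auto simp: box_ne_empty)
  define t where "t i = (x \<bullet> i - (a + c) \<bullet> i) / ((b + d) \<bullet> i - (a + c) \<bullet> i)" for i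
  have t: "0 < t i \<and> t i < 1 \<and> x \<bullet> i = (a + c) \<bullet> i + t i * ((b + d) \<bullet> i - (a + c) \<bullet> i)" if "i \<in> Basis" for i
    using x ab[OF that] that by (auto simp: t_def mem_box inner_add_left field_simps)
  define y z where "y = (\<Sum>i\<in>Basis. (a \<bullet> i + t i * (b \<bullet> i - a \<bullet> i)) *\<^sub>R i)"
    and "z = (\<Sum>i\<in>Basis. (c \<bullet> i + t i * (d \<bullet> i - c \<bullet> i)) *\<^sub>R i)"
  have between: "u < u + s * (v - u) \<and> u + s * (v - u) < v" if "0 < s" "s < 1" "u < v" for u v s :: real
  proof -
    have "s * (v - u) < 1 * (v - u)" using that by (intro mult_strict_right_mono) auto
    moreover have "0 < s * (v - u)" using that by auto
    ultimately show ?thesis by auto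
  qed
  have "y \<in> box a b" "z \<in> box c d"
    using t ab between by (auto simp: mem_box y_def z_def)
  moreover have "x = y + z"
  proof (rule euclidean_eqI)
    fix i :: 'a assume i: "i \<in> Basis"
    have "y \<bullet> i = a \<bullet> i + t i * (b \<bullet> i - a \<bullet> i)" "z \<bullet> i = c \<bullet> i + t i * (d \<bullet> i - c \<bullet> i)"
      using i by (simp_all add: y_def z_def)
    then show "x \<bullet> i = (y + z) \<bullet> i"
      using t[OF i] by (simp add: inner_add_left algebra_simps)
  qed
  ultimately show "x \<in> box a b + box c d" by (auto simp: set_plus_def)
qed

text \<open>
  The Brunn-Minkowski inequality for a particular pair, raised to the power of the dimension so that it is
  additive when both sets are cut in equal proportions.
\<close>
abbreviation BM :: "'a::euclidean_space set \<Rightarrow> 'a set \<Rightarrow> bool" where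
  "BM A B \<equiv> (root DIM('a) (measure lebesgue A) + root DIM('a) (measure lebesgue B)) ^ DIM('a)
              \<le> measure lebesgue (A + B)"

lemma measure_box_nonempty:
  "box a b \<noteq> {} \<Longrightarrow> measure lebesgue (box a b :: 'a::euclidean_space set) = (\<Prod>i\<in>Basis. b \<bullet> i - a \<bullet> i)"
  by (subst measure_completion) (auto simp: measure_lborel_box_eq box_ne_empty less_imp_le inner_diff_left)

lemma BM_box:
  fixes a b c d :: "'a::euclidean_space"
  assumes "box a b \<noteq> {}" "box c d \<noteq> {}"
  shows "BM (box a b) (box c d)"
proof -
  have ab: "a \<bullet> i < b \<bullet> i" "c \<bullet> i < d \<bullet> i" if "i \<in> Basis" for i
    using assms that by (auto simp: box_ne_empty)
  have ne: "box (a + c) (b + d) \<noteq> {}"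
    using ab by (auto simp: box_ne_empty inner_add_left intro: add_strict_mono)
  let ?n = "DIM('a)"
  have "root ?n (measure lebesgue (box a b)) + root ?n (measure lebesgue (box c d))
      \<le> root ?n (\<Prod>i\<in>Basis. (b \<bullet> i - a \<bullet> i) + (d \<bullet> i - c \<bullet> i))"
    unfolding measure_box_nonempty[OF assms(1)] measure_box_nonempty[OF assms(2)]
    by (rule root_prod_superadditive) (use ab in auto)
  also have "(\<Prod>i\<in>Basis. (b \<bullet> i - a \<bullet> i) + (d \<bullet> i - c \<bullet> i)) = measure lebesgue (box (a + c) (b + d))"
    unfolding measure_box_nonempty[OF ne] by (intro prod.cong) (auto simp: inner_add_left)
  finally have "(root ?n (measure lebesgue (box a b)) + root ?n (measure lebesgue (box c d))) ^ ?n
      \<le> root ?n (measure lebesgue (box (a + c) (b + d))) ^ ?n"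
    by (intro power_mono) auto
  also have "\<dots> = measure lebesgue (box (a + c) (b + d))" by simp
  also have "\<dots> \<le> measure lebesgue (box a b + box c d)"
    using box_subset_plus[OF assms]
    by (intro measure_mono_fmeasurable) (auto intro!: lmeasurable_open open_set_plus bounded_set_plus bounded_box)
  finally show ?thesis .
qed

definition box_family :: "'a::euclidean_space set set \<Rightarrow> bool" where
  "box_family \<D> \<longleftrightarrow> finite \<D> \<and> \<D> \<noteq> {} \<and> disjoint \<D> \<and> (\<forall>X\<in>\<D>. X \<noteq> {} \<and> (\<exists>a b. X = box a b))"

lemma box_family_Union:
  assumes "box_family \<D>"
  shows "open (\<Union>\<D>)" "bounded (\<Union>\<D>)" "\<Union>\<D> \<noteq> {}" "\<Union>\<D> \<in> lmeasurable" "0 < measure lebesgue (\<Union>\<D>)"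
proof -
  show *: "open (\<Union>\<D>)" "bounded (\<Union>\<D>)" "\<Union>\<D> \<noteq> {}"
    using assms by (auto simp: box_family_def open_box bounded_box intro!: bounded_Union open_Union)
  then show m: "\<Union>\<D> \<in> lmeasurable" by (intro lmeasurable_open)
  show "0 < measure lebesgue (\<Union>\<D>)"
    using open_not_negligible[OF *(1,3)] m by (simp add: negligible_iff_measure0 zero_less_measure_iff)
qed

text \<open>
  Boxes that miss \<open>H\<close> are discarded, so a cut that separates two members makes the family smaller on
  either side. This is what drives the induction in \<open>BM_box_family\<close>.
\<close>
lemma box_family_cut:
  fixes \<D> :: "'a::euclidean_space set set"
  assumes D: "box_family \<D>" and H: "\<And>a b. \<exists>a' b'. box a b \<inter> H = box a' b'"
    and ne: "\<Union>\<D> \<inter> H \<noteq> {}"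
  obtains \<D>' where "box_family \<D>'" "\<Union>\<D>' = \<Union>\<D> \<inter> H" "card \<D>' \<le> card \<D>"
    "(\<exists>X\<in>\<D>. X \<inter> H = {}) \<Longrightarrow> card \<D>' < card \<D>"
proof 
  define \<D>' where "\<D>' = (\<lambda>X. X \<inter> H) ` {X \<in> \<D>. X \<inter> H \<noteq> {}}"
  have fin: "finite \<D>" using D by (simp add: box_family_def)
  show "\<Union>\<D>' = \<Union>\<D> \<inter> H" by (auto simp: \<D>'_def)
  have "disjoint \<D>'"
  proof (rule disjointI)
    fix X Y assume "X \<in> \<D>'" "Y \<in> \<D>'" "X \<noteq> Y"
    then obtain X' Y' where XY: "X' \<in> \<D>" "Y' \<in> \<D>" "X' \<noteq> Y'" "X = X' \<inter> H" "Y = Y' \<inter> H"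
      by (auto simp: \<D>'_def)
    then have "X' \<inter> Y' = {}" using D by (auto simp: box_family_def dest: disjointD)
    with XY show "X \<inter> Y = {}" by blast
  qed
  moreover have "X \<noteq> {} \<and> (\<exists>a b. X = box a b)" if X: "X \<in> \<D>'" for X
  proof -
    obtain Y where Y: "Y \<in> \<D>" "X = Y \<inter> H" "X \<noteq> {}"
      using X by (auto simp: \<D>'_def)
    moreover obtain a b where "Y = box a b" using D Y(1) unfolding box_family_def by metis
    ultimately show ?thesis using H[of a b] by auto
  qed
  moreover have "finite \<D>'" "\<D>' \<noteq> {}"
    using fin ne unfolding \<D>'_def by auto
  ultimately show "box_family \<D>'"
    unfolding box_family_def by simp
  have le: "card \<D>' \<le> card {X \<in> \<D>. X \<inter> H \<noteq> {}}"
    unfolding \<D>'_def by (rule card_image_le) (use fin in auto)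
  also have "\<dots> \<le> card \<D>" by (rule card_mono) (use fin in auto)
  finally show "card \<D>' \<le> card \<D>" .
  assume "\<exists>X\<in>\<D>. X \<inter> H = {}"
  then have "card {X \<in> \<D>. X \<inter> H \<noteq> {}} < card \<D>"
    by (intro psubset_card_mono) (use fin in auto)
  with le show "card \<D>' < card \<D>" by simp
qed

lemma box_Int_below:
  assumes "i \<in> Basis"
  shows "\<exists>a' b'. box a b \<inter> {x. x \<bullet> i < c} = box a' (b'::'a::euclidean_space)"
proof (intro exI)
  show "box a b \<inter> {x. x \<bullet> i < c} = box a (\<Sum>j\<in>Basis. (if j = i then min (b \<bullet> j) c else b \<bullet> j) *\<^sub>R j)"
    using assms by (auto simp: mem_box split: if_splits)
qed

lemma box_Int_above:
  assumes "i \<in> Basis"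
  shows "\<exists>a' b'. box a b \<inter> {x. c < x \<bullet> i} = box a' (b'::'a::euclidean_space)"
proof (intro exI)
  show "box a b \<inter> {x. c < x \<bullet> i} = box (\<Sum>j\<in>Basis. (if j = i then max (a \<bullet> j) c else a \<bullet> j) *\<^sub>R j) b"
    using assms by (auto simp: mem_box split: if_splits)
qed

lemma separate_boxes:
  fixes a b c d :: "'a::euclidean_space"
  assumes ne: "box a b \<noteq> {}" "box c d \<noteq> {}" and disj: "box a b \<inter> box c d = {}"
  obtains i t where "i \<in> Basis"
    "box a b \<subseteq> {x. x \<bullet> i < t} \<and> box c d \<subseteq> {x. t < x \<bullet> i} \<or>
     box c d \<subseteq> {x. x \<bullet> i < t} \<and> box a b \<subseteq> {x. t < x \<bullet> i}"
proof -
  have ab: "a \<bullet> i < b \<bullet> i" "c \<bullet> i < d \<bullet> i" if "i \<in> Basis" for i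
    using ne that by (auto simp: box_ne_empty)
  have "\<exists>i\<in>Basis. b \<bullet> i \<le> c \<bullet> i \<or> d \<bullet> i \<le> a \<bullet> i"
    using disj ab unfolding disjoint_interval by (meson not_le order_less_imp_le)
  then obtain i where i: "i \<in> Basis" "b \<bullet> i \<le> c \<bullet> i \<or> d \<bullet> i \<le> a \<bullet> i" by blast
  show ?thesis
  proof (cases "b \<bullet> i \<le> c \<bullet> i")
    case True
    have "box a b \<subseteq> {x. x \<bullet> i < b \<bullet> i}" "box c d \<subseteq> {x. b \<bullet> i < x \<bullet> i}"
      using i(1) True by (auto simp: mem_box intro: order_le_less_trans)
    then show ?thesis by (intro that[OF i(1)]) blast
  next
    case False
    then have "box c d \<subseteq> {x. x \<bullet> i < d \<bullet> i}" "box a b \<subseteq> {x. d \<bullet> i < x \<bullet> i}"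
      using i by (auto simp: mem_box intro: order_le_less_trans)
    then show ?thesis by (intro that[OF i(1)]) blast
  qed
qed

text \<open>
  The key step of Hadwiger and Ohmann. If hyperplanes at heights \<open>s\<close> and \<open>t\<close> cut off the same fraction
  \<open>\<tau>\<close> of \<open>A\<close> and of \<open>B\<close>, the sums of the lower parts and of the upper parts are separated by the
  hyperplane at height \<open>s + t\<close>. The bounds for them are \<open>\<tau>\<close> and \<open>1 - \<tau>\<close> times the bound for \<open>A\<close> and
  \<open>B\<close>, since the bound is homogeneous of degree one in the pair of volumes.
\<close>
lemma BM_proportional_cut:
  fixes A B :: "'a::euclidean_space set"
  assumes e: "e \<noteq> 0"
    and A: "A \<in> lmeasurable" "0 < measure lebesgue A" and B: "B \<in> lmeasurable" and AB: "A + B \<in> lmeasurable"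
    and split: "volume_below A e s / measure lebesgue A = \<tau>"  "volume_below B e t = \<tau> * measure lebesgue B"
    and low: "BM (A \<inter> {x. x \<bullet> e < s}) (B \<inter> {x. x \<bullet> e < t})"
             "A \<inter> {x. x \<bullet> e < s} + B \<inter> {x. x \<bullet> e < t} \<in> lmeasurable"
    and up: "BM (A \<inter> {x. s < x \<bullet> e}) (B \<inter> {x. t < x \<bullet> e})"
             "A \<inter> {x. s < x \<bullet> e} + B \<inter> {x. t < x \<bullet> e} \<in> lmeasurable"
  shows "BM A B"
proof -
  let ?n = "DIM('a)" and ?\<mu> = "measure lebesgue"
  let ?Al = "A \<inter> {x. x \<bullet> e < s}" and ?Au = "A \<inter> {x. s < x \<bullet> e}"
  let ?Bl = "B \<inter> {x. x \<bullet> e < t}" and ?Bu = "B \<inter> {x. t < x \<bullet> e}"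
  have \<tau>: "volume_below A e s = \<tau> * ?\<mu> A" using split A(2) by (simp add: field_simps)
  have \<tau>01: "0 \<le> \<tau>" "\<tau> \<le> 1"
    using volume_below_nonneg[of A e s] volume_below_le[OF A(1), of e s] A(2)
    unfolding split(1)[symmetric] by auto
  have scale: "(root ?n (\<sigma> * ?\<mu> A) + root ?n (\<sigma> * ?\<mu> B)) ^ ?n = \<sigma> * (root ?n (?\<mu> A) + root ?n (?\<mu> B)) ^ ?n"
    if "0 \<le> \<sigma>" for \<sigma>
    using that by (simp add: real_root_mult distrib_left[symmetric] power_mult_distrib)
  have disj: "(?Al + ?Bl) \<inter> (?Au + ?Bu) = {}"
  proof -
    have "z \<bullet> e < s + t" if "z \<in> ?Al + ?Bl" for z
      using that by (auto simp: set_plus_def inner_add_left)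
    moreover have "s + t < z \<bullet> e" if "z \<in> ?Au + ?Bu" for z
      using that by (auto simp: set_plus_def inner_add_left)
    ultimately show ?thesis by (meson disjoint_iff less_asym)
  qed
  have "(root ?n (?\<mu> A) + root ?n (?\<mu> B)) ^ ?n
      = \<tau> * (root ?n (?\<mu> A) + root ?n (?\<mu> B)) ^ ?n + (1 - \<tau>) * (root ?n (?\<mu> A) + root ?n (?\<mu> B)) ^ ?n"
    by (simp add: algebra_simps)
  also have "\<dots> = (root ?n (?\<mu> ?Al) + root ?n (?\<mu> ?Bl)) ^ ?n + (root ?n (?\<mu> ?Au) + root ?n (?\<mu> ?Bu)) ^ ?n"
    unfolding volume_strictly_below(2)[OF A(1) e] volume_strictly_below(2)[OF B e]
      volume_above(2)[OF A(1)] volume_above(2)[OF B] \<tau> split(2)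
    using scale[OF \<tau>01(1)] scale[of "1 - \<tau>"] \<tau>01(2) by (simp add: left_diff_distrib)
  also have "\<dots> \<le> ?\<mu> (?Al + ?Bl) + ?\<mu> (?Au + ?Bu)" using low up by simp
  also have "\<dots> = ?\<mu> ((?Al + ?Bl) \<union> (?Au + ?Bu))"
    using measure_Un2[OF low(2) up(2)] disj by (simp add: Diff_triv Int_commute)
  also have "\<dots> \<le> ?\<mu> (A + B)"
    by (intro measure_mono_fmeasurable AB fmeasurableD fmeasurable.Un low up) (auto simp: set_plus_def)
  finally show ?thesis .
qed

text \<open>
  The hyperplane is chosen to separate two boxes of \<open>\<A>\<close>; the parallel hyperplane that cuts \<open>\<B>\<close> in the
  same proportion exists by the intermediate value theorem and does not increase the number of boxes
  in \<open>\<B>\<close>.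
\<close>
lemma BM_box_family_step:
  fixes \<A> \<B> :: "'a::euclidean_space set set"
  assumes A: "box_family \<A>" and B: "box_family \<B>" and two: "2 \<le> card \<A>"
    and IH: "\<And>\<A>' \<B>'. box_family \<A>' \<Longrightarrow> box_family \<B>' \<Longrightarrow> card \<A>' + card \<B>' < card \<A> + card \<B>
          \<Longrightarrow> BM (\<Union>\<A>') (\<Union>\<B>' :: 'a set)"
  shows "BM (\<Union>\<A>) (\<Union>\<B>)"
proof -
  let ?\<mu> = "measure lebesgue"
  obtain X Y where XY: "X \<in> \<A>" "Y \<in> \<A>" "X \<noteq> Y"
    using two by (metis One_nat_def card_le_Suc0_iff_eq finite.emptyI not_less_eq_eq numeral_2_eq_2 A box_family_def)
  then obtain a b c d where abcd: "X = box a b" "Y = box c d" "X \<noteq> {}" "Y \<noteq> {}"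
    using A unfolding box_family_def by metis
  have "X \<inter> Y = {}" using A XY by (auto simp: box_family_def pairwise_def disjnt_def)
  then obtain i s where i: "i \<in> Basis" and sep: 
    "X \<subseteq> {x. x \<bullet> i < s} \<and> Y \<subseteq> {x. s < x \<bullet> i} \<or> Y \<subseteq> {x. x \<bullet> i < s} \<and> X \<subseteq> {x. s < x \<bullet> i}"
    using separate_boxes[of a b c d] abcd by metis
  have i0: "i \<noteq> 0" using i by auto
  let ?L = "\<lambda>t. {x::'a. x \<bullet> i < t}" and ?U = "\<lambda>t. {x::'a. t < x \<bullet> i}"
  note [simp] = box_family_Union(4,5)[OF A] box_family_Union(4,5)[OF B]
  obtain Z W where ZW: "Z \<in> \<A>" "W \<in> \<A>" "Z \<noteq> {}" "W \<noteq> {}" "Z \<subseteq> ?L s" "W \<subseteq> ?U s"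
    using sep XY abcd(3,4) by blast
  then have neA: "\<Union>\<A> \<inter> ?L s \<noteq> {}" "\<Union>\<A> \<inter> ?U s \<noteq> {}"
    by blast+
  have "W \<inter> ?L s = {}" "Z \<inter> ?U s = {}"
    using ZW(5,6) by auto
  with ZW have drop: "\<exists>Z\<in>\<A>. Z \<inter> ?L s = {}" "\<exists>Z\<in>\<A>. Z \<inter> ?U s = {}"
    by blast+
  obtain \<A>l where Al: "box_family \<A>l" "\<Union>\<A>l = \<Union>\<A> \<inter> ?L s" "card \<A>l < card \<A>"
    using box_family_cut[OF A box_Int_below[OF i] neA(1)] drop by metis
  obtain \<A>u where Au: "box_family \<A>u" "\<Union>\<A>u = \<Union>\<A> \<inter> ?U s" "card \<A>u < card \<A>"
    using box_family_cut[OF A box_Int_above[OF i] neA(2)] drop by metis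
  define \<tau> where "\<tau> = volume_below (\<Union>\<A>) i s / ?\<mu> (\<Union>\<A>)"
  have pos: "0 < volume_below (\<Union>\<A>) i s" "volume_below (\<Union>\<A>) i s < ?\<mu> (\<Union>\<A>)"
    using box_family_Union(5)[OF Al(1)] box_family_Union(5)[OF Au(1)] unfolding Al(2) Au(2)
    by (simp_all add: volume_strictly_below i0 volume_above)
  then have \<tau>: "0 < \<tau>" "\<tau> < 1" by (auto simp: \<tau>_def divide_simps)
  then have "0 < \<tau> * ?\<mu> (\<Union>\<B>)" "\<tau> * ?\<mu> (\<Union>\<B>) < ?\<mu> (\<Union>\<B>)" by simp_all
  then obtain t where t: "volume_below (\<Union>\<B>) i t = \<tau> * ?\<mu> (\<Union>\<B>)"
    using volume_below_IVT[of "\<Union>\<B>" i "\<tau> * ?\<mu> (\<Union>\<B>)"] i0 by auto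
  have "0 < ?\<mu> (\<Union>\<B> \<inter> ?L t)" "0 < ?\<mu> (\<Union>\<B> \<inter> ?U t)"
    using \<tau> by (simp_all add: volume_strictly_below i0 volume_above t)
  then have neB: "\<Union>\<B> \<inter> ?L t \<noteq> {}" "\<Union>\<B> \<inter> ?U t \<noteq> {}"
    by (metis measure_empty less_irrefl)+
  obtain \<B>l where Bl: "box_family \<B>l" "\<Union>\<B>l = \<Union>\<B> \<inter> ?L t" "card \<B>l \<le> card \<B>"
    using box_family_cut[OF B box_Int_below[OF i] neB(1)] by metis
  obtain \<B>u where Bu: "box_family \<B>u" "\<Union>\<B>u = \<Union>\<B> \<inter> ?U t" "card \<B>u \<le> card \<B>"
    using box_family_cut[OF B box_Int_above[OF i] neB(2)] by metis
  have m: "\<Union>\<A>' + \<Union>\<B>' \<in> lmeasurable" if "box_family \<A>'" "box_family \<B>'" for \<A>' \<B>' :: "'a set set"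
    using that by (intro lmeasurable_open bounded_set_plus open_set_plus box_family_Union)
  show ?thesis
  proof (rule BM_proportional_cut[OF i0 _ _ _ _ \<tau>_def[symmetric] t])
    show "BM (\<Union>\<A> \<inter> ?L s) (\<Union>\<B> \<inter> ?L t)"
      unfolding Al(2)[symmetric] Bl(2)[symmetric] by (rule IH) (use Al Bl in auto)
    show "BM (\<Union>\<A> \<inter> ?U s) (\<Union>\<B> \<inter> ?U t)"
      unfolding Au(2)[symmetric] Bu(2)[symmetric] by (rule IH) (use Au Bu in auto)
    show "\<Union>\<A> \<inter> ?L s + \<Union>\<B> \<inter> ?L t \<in> lmeasurable"
      unfolding Al(2)[symmetric] Bl(2)[symmetric] by (rule m) (use Al Bl in auto)
    show "\<Union>\<A> \<inter> ?U s + \<Union>\<B> \<inter> ?U t \<in> lmeasurable"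
      unfolding Au(2)[symmetric] Bu(2)[symmetric] by (rule m) (use Au Bu in auto)
  qed (auto intro!: m A B)
qed

lemma BM_box_family:
  fixes \<A> \<B> :: "'a::euclidean_space set set"
  assumes "box_family \<A>" "box_family \<B>"
  shows "BM (\<Union>\<A>) (\<Union>\<B>)"
  using assms
proof (induction "card \<A> + card \<B>" arbitrary: \<A> \<B> rule: less_induct)
  case less
  have pos: "card \<A> > 0" "card \<B> > 0"
    using less.prems by (auto simp: box_family_def card_gt_0_iff)
  consider "2 \<le> card \<A>" | "2 \<le> card \<B>" | "card \<A> = 1" "card \<B> = 1"
    using pos by linarith
  then show ?case
  proof cases
    case 1
    show ?thesis by (rule BM_box_family_step[OF less.prems 1]) (rule less.hyps)
  next
    case 2
    have "BM (\<Union>\<B>) (\<Union>\<A>)"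
    proof (rule BM_box_family_step[OF less.prems(2,1) 2])
      fix \<A>' \<B>' :: "'a set set"
      assume *: "box_family \<A>'" "box_family \<B>'" "card \<A>' + card \<B>' < card \<B> + card \<A>"
      then have "BM (\<Union>\<B>') (\<Union>\<A>')" by (intro less.hyps) auto
      then show "BM (\<Union>\<A>') (\<Union>\<B>')" by (simp add: add.commute)
    qed
    then show ?thesis by (simp add: add.commute)
  next
    case 3
    then obtain X Y where "\<A> = {X}" "\<B> = {Y}" by (metis card_1_singletonE)
    moreover from this obtain a b c d where "X = box a b" "Y = box c d" "X \<noteq> {}" "Y \<noteq> {}"
      using less.prems unfolding box_family_def by fastforce
    ultimately show ?thesis using BM_box[of a b c d] by simp
  qed
qed

section \<open>The Brunn-Minkowski inequality\<close>

lemma increasing_union_measure_gt: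
  fixes F :: "nat \<Rightarrow> 'a::euclidean_space set"
  assumes F: "\<And>n. F n \<in> lmeasurable" "incseq F" and U: "U \<in> lmeasurable" "\<And>n. F n \<subseteq> U"
    and null: "negligible (U - (\<Union>n. F n))" and m: "m < measure lebesgue U"
  obtains n where "m < measure lebesgue (F (Suc n))"
proof -
  have V: "(\<Union>n. F n) \<in> lmeasurable"
    by (rule fmeasurableI2[OF U(1)]) (use U F in auto)
  have "(\<lambda>n. measure lebesgue (F n)) \<longlonglongrightarrow> measure lebesgue (\<Union>n. F n)"
    using F fmeasurableD2[OF V] by (intro Lim_measure_incseq) auto
  moreover have "measure lebesgue (\<Union>n. F n) = measure lebesgue U"
  proof (rule measure_negligible_symdiff)
    have "(U - (\<Union>n. F n)) \<union> ((\<Union>n. F n) - U) = U - (\<Union>n. F n)" using U(2) by blast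
    then show "negligible ((U - (\<Union>n. F n)) \<union> ((\<Union>n. F n) - U))" using null by simp
  qed (use U in auto)
  ultimately have "\<forall>\<^sub>F n in sequentially. m < measure lebesgue (F n)"
    using m by (metis order_tendstoD(1))
  then obtain N where "\<And>n. n \<ge> N \<Longrightarrow> m < measure lebesgue (F n)"
    by (auto simp: eventually_sequentially)
  then show ?thesis using that[of N] by simp
qed

lemma compact_subset_measure_gt:
  fixes S :: "'a::euclidean_space set"
  assumes S: "S \<in> lmeasurable" and m: "m < measure lebesgue S"
  obtains K where "compact K" "K \<subseteq> S" "m < measure lebesgue K"
proof -
  obtain N C where N: "negligible N" and C: "\<And>n::nat. compact (C n)" and eq: "S = (\<Union>n. C n) \<union> N"
    using lebesgue_regular_inner[of S] S by auto
  have K: "compact (\<Union>k<n. C k)" "(\<Union>k<n. C k) \<subseteq> S" for n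
    using C eq by auto
  obtain n where "m < measure lebesgue (\<Union>k<Suc n. C k)"
  proof (rule increasing_union_measure_gt[of "\<lambda>n. \<Union>k<n. C k" S m])
    show "negligible (S - (\<Union>n. \<Union>k<n. C k))"
      using eq by (intro negligible_subset[OF N]) blast
    show "incseq (\<lambda>n. \<Union>k<n. C k)"
      by (intro monoI UN_mono) auto
  qed (use K S m in \<open>auto intro: lmeasurable_compact\<close>)
  then show ?thesis using K by (intro that[of "\<Union>k<Suc n. C k"])
qed

text \<open>
  A covering of \<open>U\<close> by nonoverlapping closed boxes inside \<open>U\<close>, as provided by \<open>covering_lemma\<close>, loses only a
  null set when the boxes are replaced by their interiors; finitely many of them carry almost all the volume.
\<close>
lemma box_family_measure_gt:
  fixes U :: "'a::euclidean_space set"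
  assumes U: "open U" "bounded U" "U \<noteq> {}" and m: "m < measure lebesgue U"
  obtains \<D> where "box_family \<D>" "\<Union>\<D> \<subseteq> U" "m < measure lebesgue (\<Union>\<D>)"
proof -
  obtain a where a: "U \<subseteq> box (- a) (a::'a)" using bounded_subset_box_symmetric[OF U(2)] by blast
  then have r: "U \<subseteq> cbox (- a) a" "box (- a) a \<noteq> {}" using U(3) box_subset_cbox by blast+
  have "\<exists>e>0. ball x e \<subseteq> U" if "x \<in> U" for x using U(1) that open_contains_ball by blast
  then obtain e where e: "\<And>x. x \<in> U \<Longrightarrow> e x > 0 \<and> ball x (e x) \<subseteq> U" by metis
  define g where "g x = (if x \<in> U then ball x (e x) else ball x 1)" for x
  have "gauge g" unfolding gauge_def g_def using e by auto
  then obtain \<D> where D: "countable \<D>" 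
      "\<And>K. K \<in> \<D> \<Longrightarrow> interior K \<noteq> {} \<and> (\<exists>c d. K = cbox c d)"
      "pairwise (\<lambda>A B. interior A \<inter> interior B = {}) \<D>"
      "\<And>K. K \<in> \<D> \<Longrightarrow> \<exists>x \<in> U \<inter> K. K \<subseteq> g x"
      "U \<subseteq> \<Union>\<D>"
    using covering_lemma[OF r, of g] by metis
  have sub: "K \<subseteq> U" if "K \<in> \<D>" for K
    using D(4)[OF that] e by (auto simp: g_def)
  have "\<D> \<noteq> {}" using D(5) U(3) by auto
  then obtain f :: "nat \<Rightarrow> 'a set" where f: "range f = \<D>"
    using D(1) by (metis range_from_nat_into)
  define F where "F n = (\<lambda>k. interior (f k)) ` {..<n}" for n :: nat
  have fD: "f k \<in> \<D>" for k using f by auto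
  have int: "\<exists>a b. interior (f k) = box a b" "interior (f k) \<noteq> {}" "negligible (frontier (f k))" for k
  proof -
    obtain c d where *: "f k = cbox c d" "interior (f k) \<noteq> {}" using D(2)[OF fD[of k]] by metis
    then show "\<exists>a b. interior (f k) = box a b" "interior (f k) \<noteq> {}" by auto
    show "negligible (frontier (f k))" unfolding *(1) by (intro negligible_convex_frontier convex_box)
  qed
  have fam: "box_family (F (Suc n))" for n
  proof -
    have "disjoint (F (Suc n))"
    proof (rule disjointI)
      fix X Y assume "X \<in> F (Suc n)" "Y \<in> F (Suc n)" "X \<noteq> Y"
      moreover from this obtain i j where "X = interior (f i)" "Y = interior (f j)"
        by (auto simp: F_def simp del: lessThan_Suc)
      ultimately show "X \<inter> Y = {}" using pairwiseD[OF D(3) fD[of i] fD[of j]] by metis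
    qed
    moreover have "X \<noteq> {} \<and> (\<exists>a b. X = box a b)" if "X \<in> F (Suc n)" for X
      using that int unfolding F_def by blast
    moreover have "finite (F (Suc n))" "F (Suc n) \<noteq> {}" by (auto simp: F_def)
    ultimately show ?thesis unfolding box_family_def by simp
  qed
  have subU: "\<Union>(F n) \<subseteq> U" for n
    using sub fD interior_subset unfolding F_def by blast
  obtain n where "m < measure lebesgue (\<Union>(F (Suc n)))"
  proof (rule increasing_union_measure_gt[of "\<lambda>n. \<Union>(F n)" U m])
    show "\<Union>(F n) \<in> lmeasurable" for n
      by (intro lmeasurable_open bounded_subset[OF U(2) subU]) (auto simp: F_def)
    show "incseq (\<lambda>n. \<Union>(F n))" unfolding F_def by (intro monoI Union_mono image_mono) auto
    have "U - (\<Union>n. \<Union>(F n)) \<subseteq> (\<Union>k. frontier (f k))"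
    proof
      fix x assume x: "x \<in> U - (\<Union>n. \<Union>(F n))"
      then obtain k where k: "x \<in> f k" using D(5) f by blast
      have "x \<notin> interior (f k)" using x by (auto simp: F_def)
      then show "x \<in> (\<Union>k. frontier (f k))" using k closure_subset by (auto simp: frontier_def)
    qed
    moreover have "negligible (\<Union>k. frontier (f k))" using int(3) by (intro negligible_Union_nat) auto
    ultimately show "negligible (U - (\<Union>n. \<Union>(F n)))" by (rule negligible_subset[rotated])
  qed (use lmeasurable_open[OF U(2,1)] m subU in auto)
  then show ?thesis using fam subU that by blast
qed

lemma scaled_le_imp_le:
  fixes x y :: real
  assumes "\<And>t. 0 < t \<Longrightarrow> t < 1 \<Longrightarrow> t * x \<le> y"
  shows "x \<le> y"
proof (rule tendsto_upperbound)
  show "((\<lambda>t. t * x) \<longlongrightarrow> x) (at_left 1)" by (auto intro!: tendsto_eq_intros)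
  show "\<forall>\<^sub>F t in at_left 1. t * x \<le> y"
    by (rule eventually_mono[OF eventually_at_left_real[of 0 1]]) (auto intro: assms)
qed auto

text \<open>
  Homogeneity allows approximation up to a factor \<open>t < 1\<close> in both volumes at once; for
  a null set the condition on the volume is void.
\<close>
lemma BM_by_approximation:
  fixes A B :: "'a::euclidean_space set"
  assumes AB: "A + B \<in> lmeasurable"
    and approx: "\<And>t. 0 < t \<Longrightarrow> t < 1 \<Longrightarrow> \<exists>A' B'. A' + B' \<in> lmeasurable \<and> A' + B' \<subseteq> A + B \<and> BM A' B' \<and>
       t * measure lebesgue A \<le> measure lebesgue A' \<and> t * measure lebesgue B \<le> measure lebesgue B'"
  shows "BM A B"
proof (rule scaled_le_imp_le)
  fix t :: real assume t: "0 < t" "t < 1"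
  let ?n = "DIM('a)" and ?\<mu> = "measure lebesgue"
  obtain A' B' where *: "A' + B' \<in> lmeasurable" "A' + B' \<subseteq> A + B" "BM A' B'"
       "t * ?\<mu> A \<le> ?\<mu> A'" "t * ?\<mu> B \<le> ?\<mu> B'" using approx[OF t] by blast
  have "t * (root ?n (?\<mu> A) + root ?n (?\<mu> B)) ^ ?n = (root ?n (t * ?\<mu> A) + root ?n (t * ?\<mu> B)) ^ ?n"
    using t by (simp add: real_root_mult distrib_left[symmetric] power_mult_distrib)
  also have "\<dots> \<le> (root ?n (?\<mu> A') + root ?n (?\<mu> B')) ^ ?n"
    using * t by (intro power_mono add_mono real_root_le_mono add_nonneg_nonneg) auto
  also have "\<dots> \<le> ?\<mu> (A' + B')" by (rule *)
  also have "\<dots> \<le> ?\<mu> (A + B)" using * AB by (intro measure_mono_fmeasurable) auto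
  finally show "t * (root ?n (?\<mu> A) + root ?n (?\<mu> B)) ^ ?n \<le> ?\<mu> (A + B)" .
qed

lemma BM_open:
  fixes A B :: "'a::euclidean_space set"
  assumes A: "open A" "bounded A" "A \<noteq> {}" and B: "open B" "bounded B" "B \<noteq> {}"
  shows "BM A B"
proof (rule BM_by_approximation)
  show "A + B \<in> lmeasurable" using A B by (intro lmeasurable_open bounded_set_plus open_set_plus)
  fix t :: real assume t: "0 < t" "t < 1"
  have pos: "0 < measure lebesgue U" if "open U" "bounded U" "U \<noteq> {}" for U :: "'a set"
    using open_not_negligible[OF that(1,3)] lmeasurable_open[OF that(2,1)] 
    by (simp add: negligible_iff_measure0 zero_less_measure_iff)
  obtain \<A> where a: "box_family \<A>" "\<Union>\<A> \<subseteq> A" "t * measure lebesgue A < measure lebesgue (\<Union>\<A>)"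
    using box_family_measure_gt[OF A, of "t * measure lebesgue A"] t pos[OF A] by auto
  obtain \<B> where b: "box_family \<B>" "\<Union>\<B> \<subseteq> B" "t * measure lebesgue B < measure lebesgue (\<Union>\<B>)"
    using box_family_measure_gt[OF B, of "t * measure lebesgue B"] t pos[OF B] by auto
  show "\<exists>A' B'. A' + B' \<in> lmeasurable \<and> A' + B' \<subseteq> A + B \<and> BM A' B' \<and>
       t * measure lebesgue A \<le> measure lebesgue A' \<and> t * measure lebesgue B \<le> measure lebesgue B'"
  proof (intro exI conjI)
    show "\<Union>\<A> + \<Union>\<B> \<in> lmeasurable" 
      using a b by (intro lmeasurable_open bounded_set_plus open_set_plus box_family_Union)
    show "BM (\<Union>\<A>) (\<Union>\<B>)" by (rule BM_box_family) (use a b in auto)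
    show "\<Union>\<A> + \<Union>\<B> \<subseteq> A + B" using a(2) b(2) by (rule set_plus_mono2)
  qed (use a b in auto)
qed

lemma set_plus_ball: "S + ball 0 \<rho> = (\<Union>x\<in>S. ball x \<rho>)" for S :: "'a::euclidean_space set"
proof (rule set_eqI)
  fix z
  have "z \<in> S + ball 0 \<rho> \<longleftrightarrow> (\<exists>x\<in>S. \<exists>y\<in>ball 0 \<rho>. z = x + y)" by (simp add: set_plus_def)
  also have "\<dots> \<longleftrightarrow> (\<exists>x\<in>S. z - x \<in> ball 0 \<rho>)" by (metis add_diff_cancel_left' add.commute diff_add_cancel)
  also have "\<dots> \<longleftrightarrow> z \<in> (\<Union>x\<in>S. ball x \<rho>)" by (simp add: dist_norm norm_minus_commute)
  finally show "z \<in> S + ball 0 \<rho> \<longleftrightarrow> z \<in> (\<Union>x\<in>S. ball x \<rho>)" .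
qed

text \<open>
  Both sets are approximated from inside by compact sets \<open>K\<close> and \<open>L\<close>. Since \<open>B\<close> is open, there is room to enlarge \<open>L\<close>
  by a radius \<open>e\<close> within \<open>B\<close>; giving half of that radius to \<open>K\<close> and half to \<open>L\<close> makes both open without
  leaving \<open>A + B\<close>.
\<close>
theorem Brunn_Minkowski:
  fixes A B :: "'a::euclidean_space set"
  assumes A: "A \<in> lmeasurable" "A \<noteq> {}" and B: "open B" "B \<in> lmeasurable" "B \<noteq> {}" and AB: "A + B \<in> lmeasurable"
  shows "BM A B"
proof (rule BM_by_approximation[OF AB])
  fix t :: real assume t: "0 < t" "t < 1"
  have approx: "\<exists>K. compact K \<and> K \<noteq> {} \<and> K \<subseteq> S \<and> t * measure lebesgue S \<le> measure lebesgue K"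
    if S: "S \<in> lmeasurable" "S \<noteq> {}" for S :: "'a set"
  proof (cases "measure lebesgue S = 0")
    case True
    then show ?thesis using S by (intro exI[of _ "{SOME x. x \<in> S}"]) (auto simp: some_in_eq)
  next
    case False
    then have "0 < measure lebesgue S" by (simp add: zero_less_measure_iff)
    then have "t * measure lebesgue S < measure lebesgue S" "0 < t * measure lebesgue S" using t by auto
    then show ?thesis using compact_subset_measure_gt[OF S(1), of "t * measure lebesgue S"]
      by (metis less_imp_le measure_empty not_less_iff_gr_or_eq)
  qed
  obtain K where K: "compact K" "K \<noteq> {}" "K \<subseteq> A" "t * measure lebesgue A \<le> measure lebesgue K"
    using approx[OF A] by auto
  obtain L where L: "compact L" "L \<noteq> {}" "L \<subseteq> B" "t * measure lebesgue B \<le> measure lebesgue L"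
    using approx[OF B(2,3)] by auto
  obtain e where e: "e > 0" "(\<Union>x\<in>L. ball x e) \<subseteq> B"
    using compact_subset_open_imp_ball_epsilon_subset[OF L(1) B(1) L(3)] by blast
  have sum: "S + ball 0 \<rho> = (\<Union>x\<in>S. ball x \<rho>)" for S :: "'a set" and \<rho>
    by (rule set_plus_ball)
  let ?U = "\<lambda>S. S + ball (0::'a) (e/2)"
  have bd: "open (?U S)" "bounded (?U S)" if "compact S" for S
    using that by (auto intro!: open_set_plus bounded_set_plus intro: compact_imp_bounded)
  have sup: "S \<subseteq> ?U S" for S using e by (auto simp: sum)
  have le: "measure lebesgue S \<le> measure lebesgue (?U S)" if "compact S" for S
    using that sup bd by (intro measure_mono_fmeasurable lmeasurable_open) (auto intro: lmeasurable_compact fmeasurableD)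
  show "\<exists>A' B'. A' + B' \<in> lmeasurable \<and> A' + B' \<subseteq> A + B \<and> BM A' B' \<and>
       t * measure lebesgue A \<le> measure lebesgue A' \<and> t * measure lebesgue B \<le> measure lebesgue B'"
  proof (intro exI conjI)
    show "?U K + ?U L \<in> lmeasurable" 
      using bd[OF K(1)] bd[OF L(1)] by (metis lmeasurable_open bounded_set_plus open_set_plus)
    show "BM (?U K) (?U L)" by (rule BM_open) (use bd K L sup[of K] sup[of L] in auto)
    have "ball (0::'a) (e/2) + ball 0 (e/2) \<subseteq> ball 0 e"
      by (auto simp: set_plus_def intro!: norm_triangle_lt)
    then have "?U K + ?U L \<subseteq> K + (L + ball 0 e)"
      by (metis (no_types, lifting) add.assoc add.left_commute set_plus_mono2 order_refl)
    also have "\<dots> \<subseteq> A + B" using K(3) e(2) by (intro set_plus_mono2) (auto simp: sum)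
    finally show "?U K + ?U L \<subseteq> A + B" .
  qed (use K L le[of K] le[of L] in auto)
qed

section \<open>Balanced quantile functions\<close>

text \<open>
  For small \<open>h\<close> the hypothesis reads \<open>h f' \<le> \<rho> h g'\<close>, but neither function need be differentiable.
  Averaging it over \<open>z\<close> between \<open>x\<close> and \<open>y\<close> replaces the functions by their antiderivatives \<open>F\<close> and \<open>G\<close>; the
  averaged inequality is an equality at \<open>h = 0\<close>, and its derivative there is the claim.
\<close>
lemma increment_comparison:
  fixes f g :: "real \<Rightarrow> real"
  assumes f: "continuous_on {a<..<b} f" and g: "continuous_on {a<..<b} g" and \<rho>: "0 < \<rho>"
    and inc: "\<And>z h. a < z \<Longrightarrow> 0 < h \<Longrightarrow> z + h + \<rho> * h < b \<Longrightarrow> f (z + h) - f z \<le> g (z + h + \<rho> * h) - g (z + h)"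
    and xy: "a < x" "x < y" "y < b"
  shows "f y - f x \<le> \<rho> * (g y - g x)"
proof -
  \<comment> \<open>room on both sides of \<open>{x..y}\<close> for two-sided derivatives of the antiderivatives\<close>
  define d where "d = (a + x) / 2"
  define c where "c = (y + b) / 2"
  have dc: "a < d" "d < x" "y < c" "c < b" using xy by (auto simp: d_def c_def)
  have sub: "{d..c} \<subseteq> {a<..<b}" using dc by auto
  obtain F where F: "\<And>z. z \<in> {d..c} \<Longrightarrow> (F has_vector_derivative f z) (at z within {d..c})"
    using antiderivative_continuous[OF continuous_on_subset[OF f sub]] by blast
  obtain G where G: "\<And>z. z \<in> {d..c} \<Longrightarrow> (G has_vector_derivative g z) (at z within {d..c})"
    using antiderivative_continuous[OF continuous_on_subset[OF g sub]] by blast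
  have F': "(F has_real_derivative f z) (at z)" if "d < z" "z < c" for z
    using F[of z] that at_within_Icc_at[of d z c] by (simp add: has_real_derivative_iff_has_vector_derivative)
  have G': "(G has_real_derivative g z) (at z)" if "d < z" "z < c" for z
    using G[of z] that at_within_Icc_at[of d z c] by (simp add: has_real_derivative_iff_has_vector_derivative)
  define \<Phi> where "\<Phi> h z = G (z + (h + \<rho> * h)) - G (z + h) - F (z + h) + F z" for h z
  define \<Psi> where "\<Psi> h = \<Phi> h y - \<Phi> h x" for h
  have incr: "0 \<le> \<Psi> h" if h: "0 < h" "h < (c - y) / (1 + \<rho>)" for h
  proof -
    have yh: "y + h + \<rho> * h < c" using h \<rho> by (simp add: field_simps)
    have "\<Phi> h x \<le> \<Phi> h y"
    proof (rule DERIV_nonneg_imp_nondecreasing[where f = "\<Phi> h"])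
      fix z assume z: "x \<le> z" "z \<le> y"
      have pos: "0 < \<rho> * h" using h \<rho> by simp
      have "(\<Phi> h has_real_derivative (g (z + (h + \<rho> * h)) - g (z + h) - f (z + h) + f z)) (at z)"
        unfolding \<Phi>_def using z dc yh h pos
        by (intro DERIV_diff DERIV_add DERIV_shift[THEN iffD1] F' G') linarith+
      moreover have "0 \<le> g (z + (h + \<rho> * h)) - g (z + h) - f (z + h) + f z"
        using inc[of z h] z dc yh h by (auto simp: add.assoc)
      ultimately show "\<exists>D. (\<Phi> h has_real_derivative D) (at z) \<and> 0 \<le> D" by blast
    qed (use xy in simp)
    then show ?thesis by (simp add: \<Psi>_def)
  qed
  have deriv: "((\<lambda>h. \<Phi> h z) has_real_derivative \<rho> * g z - f z) (at 0)" if "d < z" "z < c" for z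
  proof -
    have "((\<lambda>h. G (z + (h + \<rho> * h))) has_real_derivative g z * (1 + \<rho>)) (at 0)"
      using that by (intro DERIV_chain2[of G] G'[THEN DERIV_cong]) (auto intro!: derivative_eq_intros)
    moreover have "((\<lambda>h. G (z + h)) has_real_derivative g z * 1) (at 0)"
      using that by (intro DERIV_chain2[of G] G'[THEN DERIV_cong]) (auto intro!: derivative_eq_intros)
    moreover have "((\<lambda>h. F (z + h)) has_real_derivative f z * 1) (at 0)"
      using that by (intro DERIV_chain2[of F] F'[THEN DERIV_cong]) (auto intro!: derivative_eq_intros)
    moreover have "((\<lambda>h. F z) has_real_derivative 0) (at 0)" by simp
    ultimately have "((\<lambda>h. \<Phi> h z) has_real_derivative g z * (1 + \<rho>) - g z * 1 - f z * 1 + 0) (at 0)"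
      unfolding \<Phi>_def by (intro DERIV_diff DERIV_add)
    then show ?thesis by (simp add: algebra_simps)
  qed
  have "(\<Psi> has_real_derivative (\<rho> * g y - f y) - (\<rho> * g x - f x)) (at 0)"
    unfolding \<Psi>_def using dc xy by (intro DERIV_diff deriv) auto
  moreover have "\<Psi> 0 = 0" by (simp add: \<Psi>_def \<Phi>_def)
  ultimately have "((\<lambda>h. \<Psi> h / h) \<longlongrightarrow> (\<rho> * g y - f y) - (\<rho> * g x - f x)) (at 0)"
    by (simp add: has_field_derivative_iff)
  then have lim: "((\<lambda>h. \<Psi> h / h) \<longlongrightarrow> (\<rho> * g y - f y) - (\<rho> * g x - f x)) (at_right 0)"
    by (rule filterlim_mono) (auto intro: at_le)
  have "\<forall>\<^sub>F h in at_right 0. 0 \<le> \<Psi> h / h"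
    using dc \<rho> by (intro eventually_mono[OF eventually_at_right_real[of 0 "(c - y) / (1 + \<rho>)"]])
      (auto intro!: divide_nonneg_pos incr)
  then have "0 \<le> (\<rho> * g y - f y) - (\<rho> * g x - f x)"
    by (intro tendsto_lowerbound[OF lim]) auto
  then show ?thesis by (simp add: algebra_simps)
qed

text \<open>
  The hypothesis bounds an increment of \<open>f\<close> by an adjacent increment of \<open>g\<close> that is \<open>\<rho>\<close> times as long. It is
  symmetric under exchanging \<open>f\<close> with \<open>g\<close> and \<open>\<rho>\<close> with \<open>1 / \<rho>\<close>, so \<open>increment_comparison\<close> applies in both
  directions. Continuity passes from \<open>g\<close> to the monotone function \<open>f\<close> by the same bound.
\<close>
lemma balanced_quantiles:
  fixes f g :: "real \<Rightarrow> real"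
  assumes fmono: "mono_on {0<..<1} f"
    and gcont: "continuous_on {0<..<1} g" and \<rho>: "0 < \<rho>"
    and bal: "\<And>x y. x \<in> {0<..<1} \<Longrightarrow> y \<in> {0<..<1} \<Longrightarrow>
        f ((\<rho> * x + y) / (1 + \<rho>)) + g ((\<rho> * x + y) / (1 + \<rho>)) \<le> f x + g y"
    and xy: "x \<in> {0<..<1}" "y \<in> {0<..<1}"
  shows "f x - \<rho> * g x = f y - \<rho> * g y"
proof -
  have step: "f m - f (m - h) \<le> g (m + \<rho> * h) - g m"
    if "m - h \<in> {0<..<1}" "m + \<rho> * h \<in> {0<..<1}" for m h
  proof -
    have "(\<rho> * (m - h) + (m + \<rho> * h)) / (1 + \<rho>) = m * (1 + \<rho>) / (1 + \<rho>)" by (simp add: algebra_simps)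
    also have "\<dots> = m" using \<rho> by simp
    finally show ?thesis using bal[OF that] by simp
  qed
  have fcont: "continuous_on {0<..<1} f"
    unfolding continuous_on_eq_continuous_at[OF open_greaterThanLessThan]
  proof
    fix z :: real assume z: "z \<in> {0<..<1}"
    \<comment> \<open>the increment of \<open>g\<close> adjacent to the interval between \<open>v\<close> and \<open>z\<close>, on its right\<close>
    define w where "w v = g (max v z + \<rho> * \<bar>v - z\<bar>) - g (max v z)" for v
    have gz: "isCont g z" using gcont z by (simp add: continuous_on_eq_continuous_at)
    have "(w \<longlongrightarrow> g (max z z + \<rho> * \<bar>z - z\<bar>) - g (max z z)) (at z)"
      unfolding w_def using gz by (intro tendsto_diff isCont_tendsto_compose[of _ g] tendsto_intros) auto
    then have w: "(w \<longlongrightarrow> 0) (at z)" by simp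
    have "((\<lambda>v. max v z + \<rho> * \<bar>v - z\<bar>) \<longlongrightarrow> max z z + \<rho> * \<bar>z - z\<bar>) (at z)"
      by (intro tendsto_intros)
    then have "\<forall>\<^sub>F v in at z. max v z + \<rho> * \<bar>v - z\<bar> < 1" 
      using z by (intro order_tendstoD(2)) auto
    moreover have "\<forall>\<^sub>F v in at z. v \<in> {0<..<1}"
      using z by (intro eventually_at_in_open') auto
    ultimately have "\<forall>\<^sub>F v in at z. norm (f v - f z) \<le> w v"
    proof eventually_elim
      case (elim v)
      show ?case
      proof (cases "v \<le> z")
        case True
        then have "f v \<le> f z" using fmono z elim by (auto simp: mono_on_def)
        moreover have "f z - f (z - (z - v)) \<le> g (z + \<rho> * (z - v)) - g z"
          using elim True z \<rho> by (intro step) (auto simp: max_def intro: add_pos_nonneg)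
        ultimately show ?thesis using True by (simp add: w_def)
      next
        case False
        then have "f z \<le> f v" using fmono z elim by (auto simp: mono_on_def)
        moreover have "f v - f (v - (v - z)) \<le> g (v + \<rho> * (v - z)) - g v"
          using elim False z \<rho> by (intro step) (auto simp: max_def intro: add_pos_nonneg)
        ultimately show ?thesis using False by (simp add: w_def)
      qed
    qed
    then have "((\<lambda>v. f v - f z) \<longlongrightarrow> 0) (at z)"
      using w by (rule Lim_null_comparison)
    then show "isCont f z" by (simp add: isCont_def LIM_zero_iff)
  qed
  have main: "f v - f u = \<rho> * (g v - g u)" if uv: "u \<in> {0<..<1}" "v \<in> {0<..<1}" "u < v" for u v
  proof (rule antisym)
    show "f v - f u \<le> \<rho> * (g v - g u)"
    proof (rule increment_comparison[OF fcont gcont \<rho>])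
      fix z h :: real assume "0 < z" "0 < h" "z + h + \<rho> * h < 1"
      moreover have "0 < \<rho> * h" using \<open>0 < h\<close> \<rho> by simp
      ultimately show "f (z + h) - f z \<le> g (z + h + \<rho> * h) - g (z + h)"
        using step[of "z + h" h] by auto
    qed (use uv in auto)
    have "g v - g u \<le> (1 / \<rho>) * (f v - f u)"
    proof (rule increment_comparison[OF gcont fcont])
      fix z h :: real assume *: "0 < z" "0 < h" "z + h + 1 / \<rho> * h < 1"
      have "0 < h / \<rho>" using \<open>0 < h\<close> \<rho> by simp
      with * have "z < 1" "0 < z + h + h / \<rho>" "z + h + h / \<rho> < 1" by auto
      with * show "g (z + h) - g z \<le> f (z + h + 1 / \<rho> * h) - f (z + h)"
        using step[of "z + h" "- h / \<rho>"] \<rho> by (auto simp: algebra_simps)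
    qed (use uv \<rho> in auto)
    then show "\<rho> * (g v - g u) \<le> f v - f u" using \<rho> by (simp add: field_simps)
  qed
  show ?thesis
    using main[OF xy] main[OF xy(2,1)] by (cases x y rule: linorder_cases) (auto simp: algebra_simps)
qed

section \<open>Heights in the equality case\<close>

lemma open_subset_lmeasurable:
  assumes "C \<in> lmeasurable" "open X" "X \<subseteq> C"
  shows "X \<in> lmeasurable"
  using assms by (intro fmeasurableI2[OF assms(1)]) auto

text \<open>
  In contrast to \<open>BM_proportional_cut\<close>, the two cuts here are arbitrary; the freedom to vary them
  independently is what determines the equality case.
\<close>
lemma BM_below:
  fixes A B :: "'a::euclidean_space set"
  assumes A: "A \<in> lmeasurable" and B: "open B" "B \<in> lmeasurable" and C: "A + B \<in> lmeasurable" and e: "e \<noteq> 0"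
    and pos: "0 < volume_below A e s" "0 < volume_below B e u"
  shows "(root DIM('a) (volume_below A e s) + root DIM('a) (volume_below B e u)) ^ DIM('a)
           \<le> volume_below (A + B) e (s + u)"
proof -
  let ?A = "A \<inter> {x. x \<bullet> e \<le> s}" and ?B = "B \<inter> {x. x \<bullet> e < u}"
  have B': "open ?B" "?B \<in> lmeasurable" "measure lebesgue ?B = volume_below B e u"
    using B open_halfspace_lt[of e u] volume_strictly_below[OF B(2) e] by (auto simp: inner_commute)
  have ne: "?A \<noteq> {}" "?B \<noteq> {}" 
    using pos B'(3) by (auto simp: volume_below_def simp del: Int_Collect)
  have S: "?A + ?B \<in> lmeasurable"
    by (rule open_subset_lmeasurable[OF C open_set_plus[OF B'(1)]]) (auto simp: set_plus_def)
  have "(root DIM('a) (volume_below A e s) + root DIM('a) (volume_below B e u)) ^ DIM('a) \<le> measure lebesgue (?A + ?B)"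
    using Brunn_Minkowski[OF _ ne(1) B'(1,2) ne(2) S] A by (simp add: B'(3) volume_below_def)
  also have "\<dots> \<le> volume_below (A + B) e (s + u)"
    unfolding volume_below_def using C S
    by (intro measure_mono_fmeasurable) (auto simp: set_plus_def inner_add_left)
  finally show ?thesis .
qed

lemma BM_above:
  fixes A B :: "'a::euclidean_space set"
  assumes A: "A \<in> lmeasurable" and B: "open B" "B \<in> lmeasurable" and C: "A + B \<in> lmeasurable"
    and less: "volume_below A e s < measure lebesgue A" "volume_below B e u < measure lebesgue B"
  shows "(root DIM('a) (measure lebesgue A - volume_below A e s)
          + root DIM('a) (measure lebesgue B - volume_below B e u)) ^ DIM('a)
           \<le> measure lebesgue (A + B) - volume_below (A + B) e (s + u)"
proof -
  let ?A = "A \<inter> {x. s < x \<bullet> e}" and ?B = "B \<inter> {x. u < x \<bullet> e}"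
  note A' = volume_above[OF A, of s e] and B' = volume_above[OF B(2), of u e]
  have op: "open ?B" using B(1) open_halfspace_gt[of u e] by (auto simp: inner_commute)
  have ne: "?A \<noteq> {}" "?B \<noteq> {}" 
    using less A'(2) B'(2) by (auto simp del: Int_Collect)
  have S: "?A + ?B \<in> lmeasurable"
    by (rule open_subset_lmeasurable[OF C open_set_plus[OF op]]) (auto simp: set_plus_def)
  have "(root DIM('a) (measure lebesgue A - volume_below A e s)
          + root DIM('a) (measure lebesgue B - volume_below B e u)) ^ DIM('a) \<le> measure lebesgue (?A + ?B)"
    using Brunn_Minkowski[OF A'(1) ne(1) op B'(1) ne(2) S] by (simp add: A'(2) B'(2))
  also have "\<dots> \<le> measure lebesgue ((A + B) \<inter> {x. s + u < x \<bullet> e})"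
    using S volume_above(1)[OF C] by (intro measure_mono_fmeasurable) (auto simp: set_plus_def inner_add_left)
  also have "\<dots> = measure lebesgue (A + B) - volume_below (A + B) e (s + u)"
    by (rule volume_above(2)[OF C])
  finally show ?thesis .
qed

lemma volume_below_ball:
  fixes e :: "'a::euclidean_space"
  assumes e: "norm e = 1" and r: "0 < r"
  shows "volume_below (ball 0 r) e (- r) = 0" "volume_below (ball 0 r) e r = measure lebesgue (ball (0::'a) r)"
    and "strict_mono_on {- r..r} (volume_below (ball 0 r) e)"
proof -
  have le: "\<bar>x \<bullet> e\<bar> < r" if "x \<in> ball 0 r" for x
    using Cauchy_Schwarz_ineq2[of x e] e that by simp
  have "ball 0 r \<inter> {x. x \<bullet> e \<le> - r} = {}" "ball 0 r \<inter> {x. x \<bullet> e \<le> r} = ball 0 r"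
    using le by fastforce+
  then show "volume_below (ball 0 r) e (- r) = 0" "volume_below (ball 0 r) e r = measure lebesgue (ball (0::'a) r)"
    by (simp_all add: volume_below_def)
  show "strict_mono_on {- r..r} (volume_below (ball 0 r) e)"
  proof (rule strict_mono_onI)
    fix s t assume st: "s \<in> {- r..r}" "t \<in> {- r..r}" "s < t"
    let ?S = "ball 0 r \<inter> {x. s < x \<bullet> e} \<inter> {x. x \<bullet> e < t}"
    have "open ?S"
      using open_halfspace_gt[of s e] open_halfspace_lt[of e t] by (auto simp: inner_commute)
    moreover have "((s + t) / 2) *\<^sub>R e \<in> ?S"
      using st e e[unfolded norm_eq_1] by auto
    ultimately have "\<not> negligible ?S" by (metis open_not_negligible emptyE)
    moreover have S: "?S \<in> lmeasurable" using \<open>open ?S\<close> by (intro lmeasurable_open) auto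
    ultimately have "0 < measure lebesgue ?S" by (simp add: negligible_iff_measure0 zero_less_measure_iff)
    also have "\<dots> \<le> measure lebesgue ((ball 0 r \<inter> {x. x \<bullet> e \<le> t}) - (ball 0 r \<inter> {x. x \<bullet> e \<le> s}))"
      using S by (intro measure_mono_fmeasurable) (auto intro!: fmeasurable.Diff)
    also have "\<dots> = volume_below (ball 0 r) e t - volume_below (ball 0 r) e s"
      unfolding volume_below_def using st by (intro measurable_measure_Diff) auto
    finally show "volume_below (ball 0 r) e s < volume_below (ball 0 r) e t" by simp
  qed
qed

lemma volume_below_scaled_ball:
  fixes e :: "'a::euclidean_space"
  assumes e: "norm e = 1" and r: "0 < r" and \<rho>: "0 < \<rho>"
  shows "volume_below (ball (k *\<^sub>R e) (\<rho> * r)) e (\<rho> * u + k) = \<rho> ^ DIM('a) * volume_below (ball 0 r) e u"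
proof -
  have ee: "e \<bullet> e = 1" using e by (simp add: norm_eq_1)
  have "ball (k *\<^sub>R e) (\<rho> * r) \<inter> {x. x \<bullet> e \<le> \<rho> * u + k}
      = (\<lambda>x. \<rho> *\<^sub>R x + k *\<^sub>R e) ` (ball 0 r \<inter> {x. x \<bullet> e \<le> u})" (is "?L = ?T ` ?S")
  proof
    show "?T ` ?S \<subseteq> ?L"
      using \<rho> by (auto simp: dist_norm inner_add_left ee)
    show "?L \<subseteq> ?T ` ?S"
    proof
      fix y assume y: "y \<in> ?L"
      have "norm (y - k *\<^sub>R e) < \<rho> * r" using y by (simp add: dist_norm norm_minus_commute)
      then have "norm ((1 / \<rho>) *\<^sub>R (y - k *\<^sub>R e)) < r"
        using \<rho> by (simp add: pos_divide_less_eq mult.commute del: scaleR_right_diff_distrib)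
      moreover have "((1 / \<rho>) *\<^sub>R (y - k *\<^sub>R e)) \<bullet> e \<le> u"
        using y \<rho> by (simp add: inner_diff_left ee pos_divide_le_eq mult.commute)
      ultimately have "(1 / \<rho>) *\<^sub>R (y - k *\<^sub>R e) \<in> ?S" by simp
      then show "y \<in> ?T ` ?S" using \<rho> by (intro image_eqI[of _ _ "(1 / \<rho>) *\<^sub>R (y - k *\<^sub>R e)"]) auto
    qed
  qed
  then show ?thesis
    unfolding volume_below_def using \<rho> by (simp add: measure_lebesgue_affine)
qed

text \<open>
  With \<open>f\<close> and \<open>g\<close> the heights below which \<open>A\<close> and the ball have the fraction \<open>x ^ n\<close> of their volume,
  \<open>BM_below\<close> shows that \<open>A + ball 0 r\<close> has at least the fraction \<open>m ^ n\<close> below \<open>f x + g y\<close>, and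
  \<open>BM_above\<close> that it has at most that fraction below \<open>f m + g m\<close>. Hence \<open>f m + g m \<le> f x + g y\<close>, and
  \<open>balanced_quantiles\<close> gives \<open>f = \<rho> * g + k\<close>.
\<close>
lemma equality_imp_ball_heights:
  fixes A :: "'a::euclidean_space set" and e :: 'a
  assumes e: "norm e = 1" and r: "0 < r" and R: "0 < R"
    and A: "A \<in> lmeasurable" "measure lebesgue A = measure lebesgue (ball (0::'a) R)"
    and C: "A + ball 0 r \<in> lmeasurable" "measure lebesgue (A + ball 0 r) = measure lebesgue (ball (0::'a) (R + r))"
  obtains k where "\<And>s. volume_below A e s = volume_below (ball (k *\<^sub>R e) R) e s"
proof -
  define n where "n = DIM('a)"
  define \<omega> where "\<omega> = unit_ball_vol n"
  define w where "w = root n \<omega>"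
  define a b c where "a = volume_below A e" and "b = volume_below (ball 0 r) e"
    and "c = volume_below (A + ball 0 r) e"
  define \<rho> where "\<rho> = R / r"
  have n: "0 < n" by (simp add: n_def)
  have \<omega>: "0 < \<omega>" by (simp add: \<omega>_def)
  have w: "0 < w" "w ^ n = \<omega>" using n \<omega> by (simp_all add: w_def)
  have \<rho>: "0 < \<rho>" "\<rho> * r = R" using r R by (simp_all add: \<rho>_def)
  have e0: "e \<noteq> 0" using e by auto
  have mA: "measure lebesgue A = (w * R) ^ n" and mB: "measure lebesgue (ball (0::'a) r) = (w * r) ^ n"
    and mC: "measure lebesgue (A + ball 0 r) = (w * (R + r)) ^ n"
    using A(2) C(2) r R w(2) by (simp_all add: content_ball n_def[symmetric] \<omega>_def[symmetric] power_mult_distrib)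
  have mAB: "measure lebesgue A = \<rho> ^ n * measure lebesgue (ball (0::'a) r)"
    unfolding mA mB power_mult_distrib[symmetric] \<rho>(2)[symmetric] by (simp add: mult_ac)
  have amono: "a s \<le> a t" if "s \<le> t" for s t unfolding a_def by (rule volume_below_mono[OF A(1) that])
  have cmono: "c s \<le> c t" if "s \<le> t" for s t unfolding c_def by (rule volume_below_mono[OF C(1) that])
  have acont: "isCont a s" for s unfolding a_def by (rule continuous_volume_below[OF A(1) e0])
  have bcont: "isCont b s" for s unfolding b_def by (rule continuous_volume_below[OF lmeasurable_ball e0])
  note ball = volume_below_ball[OF e r, folded b_def]
  have rt: "root n (x ^ n * y ^ n) = x * y" if "0 \<le> x" "0 \<le> y" for x y
    using that n by (simp add: power_mult_distrib[symmetric] real_root_power_cancel)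

  \<comment> \<open>the root of the fraction of the ball below height \<open>u\<close>, a homeomorphism of \<open>{- r..r}\<close> onto \<open>{0..1}\<close> with inverse \<open>g\<close>\<close>
  define \<beta> where "\<beta> u = root n (b u) / (w * r)" for u
  have b\<beta>: "b u = (\<beta> u * (w * r)) ^ n" for u
    using r w n by (simp add: \<beta>_def b_def volume_below_nonneg)
  have \<beta>cont: "continuous_on {- r..r} \<beta>"
    unfolding \<beta>_def using r w by (intro continuous_intros continuous_at_imp_continuous_on ballI bcont) auto
  have \<beta>mono: "strict_mono_on {- r..r} \<beta>"
    using ball(3) r w n unfolding strict_mono_on_def \<beta>_def by (simp add: divide_strict_right_mono)
  have \<beta>end: "\<beta> (- r) = 0" "\<beta> r = 1"
    using ball(1,2) r w n unfolding mB by (auto simp: \<beta>_def real_root_power_cancel)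
  have \<beta>img: "\<beta> ` {- r..r} = {0..1}"
  proof
    show "\<beta> ` {- r..r} \<subseteq> {0..1}"
    proof
      fix x assume "x \<in> \<beta> ` {- r..r}"
      then obtain u where "x = \<beta> u" "u \<in> {- r..r}" by blast
      then show "x \<in> {0..1}"
        using strict_mono_on_leD[OF \<beta>mono, of "- r" u] strict_mono_on_leD[OF \<beta>mono, of u r] \<beta>end r by simp
    qed
    show "{0..1} \<subseteq> \<beta> ` {- r..r}"
    proof
      fix x :: real assume "x \<in> {0..1}"
      then show "x \<in> \<beta> ` {- r..r}"
        using IVT'[of \<beta> "- r" x r] \<beta>cont \<beta>end r by force
    qed
  qed
  define g where "g = inv_into {- r..r} \<beta>"
  have inj: "inj_on \<beta> {- r..r}" by (rule strict_mono_on_imp_inj_on[OF \<beta>mono])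
  have g\<beta>: "g (\<beta> u) = u" if "u \<in> {- r..r}" for u unfolding g_def using inj that by simp
  have \<beta>g: "\<beta> (g x) = x" if "x \<in> {0..1}" for x
    unfolding g_def using that \<beta>img by (simp add: f_inv_into_f)
  have gcont: "continuous_on {0<..<1} g"
    by (rule continuous_on_subset[OF continuous_on_inv[OF \<beta>cont, of g]]) (use g\<beta> \<beta>img in auto)
  have bg: "b (g x) = x ^ n * (w * r) ^ n" if "x \<in> {0<..<1}" for x
    using that by (simp add: b\<beta> \<beta>g power_mult_distrib)

  have "\<exists>s. a s = x ^ n * (w * R) ^ n" if "x \<in> {0<..<1}" for x
  proof -
    have "0 < x ^ n * (w * R) ^ n" "x ^ n * (w * R) ^ n < measure lebesgue A"
      using that R w n unfolding mA by (auto intro!: mult_pos_pos power_Suc_less_one simp: power_less_one_iff)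
    then show ?thesis using volume_below_IVT[OF A(1) e0] unfolding a_def by metis
  qed
  then obtain f where af: "\<And>x. x \<in> {0<..<1} \<Longrightarrow> a (f x) = x ^ n * (w * R) ^ n" by metis
  have fmono: "mono_on {0<..<1} f"
  proof (rule mono_onI)
    fix x y :: real assume *: "x \<in> {0<..<1}" "y \<in> {0<..<1}" "x \<le> y"
    show "f x \<le> f y"
    proof (cases "x = y")
      case False
      then have "x ^ n < y ^ n" using * n by (intro power_strict_mono) auto
      then have "a (f x) < a (f y)" using * R w by (simp add: af)
      then show ?thesis using amono[of "f y" "f x"] by linarith
    qed simp
  qed
  have low: "(x * (w * R) + y * (w * r)) ^ n \<le> c (f x + g y)" if "x \<in> {0<..<1}" "y \<in> {0<..<1}" for x y
  proof -
    have "0 < a (f x)" "0 < b (g y)" using that w R r by (auto simp: af bg)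
    then have "(root n (a (f x)) + root n (b (g y))) ^ n \<le> c (f x + g y)"
      unfolding a_def b_def c_def n_def using BM_below[OF A(1) _ _ C(1) e0] by auto
    then show ?thesis using that w R r by (simp add: af bg rt)
  qed
  have up: "c (f x + g x) \<le> (x * (w * (R + r))) ^ n" if x: "x \<in> {0<..<1}" for x
  proof -
    have x1: "0 < 1 - x ^ n" using x n by (simp add: power_less_one_iff)
    have eqs: "measure lebesgue A - a (f x) = (1 - x ^ n) * (w * R) ^ n"
              "measure lebesgue (ball (0::'a) r) - b (g x) = (1 - x ^ n) * (w * r) ^ n"
      using x by (simp_all add: af bg mA mB algebra_simps)
    moreover have "0 < (1 - x ^ n) * (w * R) ^ n" "0 < (1 - x ^ n) * (w * r) ^ n"
      using x1 w R r by auto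
    ultimately have "a (f x) < measure lebesgue A" "b (g x) < measure lebesgue (ball (0::'a) r)" by linarith+
    then have "(root n (measure lebesgue A - a (f x)) + root n (measure lebesgue (ball (0::'a) r) - b (g x))) ^ n
        \<le> measure lebesgue (A + ball 0 r) - c (f x + g x)"
      unfolding a_def b_def c_def n_def using BM_above[OF A(1) _ _ C(1)] by auto
    also have "root n (measure lebesgue A - a (f x)) = root n (1 - x ^ n) * (w * R)"
      unfolding eqs using w R n by (simp add: real_root_mult real_root_power_cancel)
    also have "root n (measure lebesgue (ball (0::'a) r) - b (g x)) = root n (1 - x ^ n) * (w * r)"
      unfolding eqs using w r n by (simp add: real_root_mult real_root_power_cancel)
    also have "(root n (1 - x ^ n) * (w * R) + root n (1 - x ^ n) * (w * r)) ^ n = (root n (1 - x ^ n) * (w * (R + r))) ^ n"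
      by (simp add: algebra_simps)
    also have "\<dots> = (1 - x ^ n) * (w * (R + r)) ^ n"
      using n x1 by (simp add: power_mult_distrib)
    finally show ?thesis unfolding mC power_mult_distrib[of x] by (simp add: left_diff_distrib)
  qed
  have bal: "f ((\<rho> * x + y) / (1 + \<rho>)) + g ((\<rho> * x + y) / (1 + \<rho>)) \<le> f x + g y"
    if x: "x \<in> {0<..<1}" and y: "y \<in> {0<..<1}" for x y
  proof -
    define m where "m = (\<rho> * x + y) / (1 + \<rho>)"
    have conv: "m = (x * R + y * r) / (R + r)"
    proof -
      have "\<rho> * x + y = (x * R + y * r) / r" "1 + \<rho> = (R + r) / r"
        using r by (simp_all add: \<rho>_def field_simps)
      then show ?thesis using r by (simp add: m_def)
    qed
    have mw: "m * (w * (R + r)) = x * (w * R) + y * (w * r)"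
    proof -
      have "m * (R + r) = x * R + y * r" unfolding conv using r R by simp
      then have "w * (m * (R + r)) = w * (x * R + y * r)" by simp
      then show ?thesis by (simp only: algebra_simps)
    qed
    have "x * R + y * r < 1 * R + 1 * r" using x y r R by (intro add_strict_mono mult_strict_right_mono) auto
    moreover have "0 < x * R + y * r" using x y r R by (intro add_pos_pos mult_pos_pos) auto
    ultimately have m: "m \<in> {0<..<1}" unfolding conv using r R by (simp add: divide_simps)
    \<comment> \<open>The volume of the sum below a height need not be strictly increasing, so the comparison of fractions
        yields one of heights only after a strict increase of \<open>y\<close>; continuity of \<open>g\<close> removes it.\<close>
    have "f m + g m \<le> f x + g y'" if y': "y < y'" "y' < 1" for y'
    proof -
      have "x * (w * R) + y * (w * r) < x * (w * R) + y' * (w * r)" using y' w r by simp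
      then have "(m * (w * (R + r))) ^ n < (x * (w * R) + y' * (w * r)) ^ n"
        unfolding mw using n x y w r R by (intro power_strict_mono) auto
      then have "c (f m + g m) < c (f x + g y')"
        using up[OF m] low[OF x, of y'] y y' by auto
      then show ?thesis using cmono[of "f x + g y'" "f m + g m"] by linarith
    qed
    then have "\<forall>\<^sub>F y' in at_right y. f m + g m \<le> f x + g y'"
      using y by (intro eventually_mono[OF eventually_at_right_real[of y 1]]) auto
    moreover have "((\<lambda>y'. f x + g y') \<longlongrightarrow> f x + g y) (at_right y)"
    proof -
      have "isCont g y" using gcont y by (simp add: continuous_on_eq_continuous_at)
      then have "(g \<longlongrightarrow> g y) (at_right y)" unfolding isCont_def by (rule filterlim_mono) (auto intro: at_le)
      then show ?thesis by (intro tendsto_intros)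
    qed
    ultimately show ?thesis unfolding m_def[symmetric] by (intro tendsto_lowerbound) auto
  qed

  define k where "k = f (1/2) - \<rho> * g (1/2)"
  have fk: "f x = \<rho> * g x + k" if "x \<in> {0<..<1}" for x
    using balanced_quantiles[OF fmono gcont \<rho>(1) bal that, of "1/2"] by (simp add: k_def)
  have eq_open: "a (\<rho> * u + k) = \<rho> ^ n * b u" if u: "- r < u" "u < r" for u
  proof -
    have "\<beta> (- r) < \<beta> u" "\<beta> u < \<beta> r" using \<beta>mono u unfolding strict_mono_on_def by auto
    then have 1: "\<beta> u \<in> {0<..<1}" by (simp add: \<beta>end)
    have "a (\<rho> * u + k) = \<beta> u ^ n * (w * R) ^ n"
      using af[OF 1] fk[OF 1] g\<beta>[of u] u by simp
    also have "\<dots> = \<rho> ^ n * b u"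
      unfolding b\<beta> \<rho>(2)[symmetric] by (simp add: power_mult_distrib mult_ac)
    finally show ?thesis .
  qed
  have eq_closed: "a (\<rho> * u + k) = \<rho> ^ n * b u" if u: "u \<in> {- r..r}" for u
  proof -
    have "a (\<rho> * u + k) - \<rho> ^ n * b u = 0"
    proof (rule continuous_constant_on_closure[of "{- r<..<r}" "\<lambda>u. a (\<rho> * u + k) - \<rho> ^ n * b u"])
      show "continuous_on (closure {- r<..<r}) (\<lambda>u. a (\<rho> * u + k) - \<rho> ^ n * b u)"
        by (intro continuous_at_imp_continuous_on ballI continuous_intros isCont_o2[OF _ acont] bcont)
    qed (use u r eq_open in auto)
    then show ?thesis by simp
  qed
  have bmono: "b s \<le> b t" if "s \<le> t" for s t unfolding b_def by (rule volume_below_mono[OF lmeasurable_ball that])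
  have eq: "a (\<rho> * u + k) = \<rho> ^ n * b u" for u
  proof (cases u "- r" rule: le_cases)
    case le
    have "a (\<rho> * u + k) \<le> a (\<rho> * (- r) + k)" using le \<rho>(1) by (intro amono add_right_mono mult_left_mono) auto
    moreover have "b u \<le> b (- r)" using le by (rule bmono)
    moreover have "0 \<le> a (\<rho> * u + k)" "0 \<le> b u" by (simp_all add: a_def b_def volume_below_nonneg)
    ultimately show ?thesis using eq_closed[of "- r"] r ball(1) by simp
  next
    case ge
    show ?thesis
    proof (cases "u \<le> r")
      case True
      then show ?thesis using ge by (intro eq_closed) auto
    next
      case False
      then have "a (\<rho> * r + k) \<le> a (\<rho> * u + k)" using \<rho>(1) by (intro amono add_right_mono mult_left_mono) auto
      moreover have "b r \<le> b u" using False by (intro bmono) simp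
      moreover have "a (\<rho> * u + k) \<le> measure lebesgue A" "b u \<le> measure lebesgue (ball (0::'a) r)"
        unfolding a_def b_def by (rule volume_below_le, use A in simp)+
      ultimately show ?thesis using eq_closed[of r] r ball(2) mAB by simp
    qed
  qed
  show ?thesis
  proof
    fix s
    have "volume_below (ball (k *\<^sub>R e) R) e s = \<rho> ^ n * b ((s - k) / \<rho>)"
      using volume_below_scaled_ball[OF e r \<rho>(1), of k "(s - k) / \<rho>"] \<rho> by (simp add: n_def b_def)
    also have "\<dots> = a s" using eq[of "(s - k) / \<rho>"] \<rho> by simp
    finally show "volume_below A e s = volume_below (ball (k *\<^sub>R e) R) e s" by (simp add: a_def)
  qed
qed

section \<open>Equality with a ball\<close>

text \<open>
  The reflection in the centre of the ball shows that \<open>H\<close> is invariant under \<open>t \<mapsto> 2 * k - t\<close>,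
  so its mean is \<open>k\<close> times its total mass.
\<close>
lemma height_mean_ball:
  fixes e :: "'a::euclidean_space" and k R :: real
  assumes e: "norm e = 1" and R: "0 < R"
  defines "H \<equiv> height_measure (ball (k *\<^sub>R e) R) e"
  shows "integrable H (\<lambda>t. t)" "(\<integral>t. t \<partial>H) = k * measure lebesgue (ball (0::'a) R)"
proof -
  let ?B = "ball (k *\<^sub>R e) R"
  have ee: "e \<bullet> e = 1" using e by (simp add: norm_eq_1)
  have B: "?B \<in> lmeasurable" by simp
  interpret finite_borel_measure H unfolding H_def by (rule finite_borel_height_measure[OF B])
  have sets: "sets H = sets borel" and space: "space H = UNIV" by (simp_all add: H_def height_measure_def)
  have fin: "finite_measure (restrict_space lebesgue ?B)"
    using B by (intro finite_measureI) (auto simp: emeasure_restrict_space space_restrict_space fmeasurable_def)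
  have bound: "\<bar>x \<bullet> e\<bar> \<le> \<bar>k\<bar> + R" if "x \<in> ?B" for x
  proof -
    have "\<bar>(x - k *\<^sub>R e) \<bullet> e\<bar> \<le> norm (x - k *\<^sub>R e)" using Cauchy_Schwarz_ineq2[of "x - k *\<^sub>R e" e] e by simp
    moreover have "norm (x - k *\<^sub>R e) < R" using that by (simp add: dist_norm norm_minus_commute)
    ultimately show ?thesis by (simp add: inner_diff_left ee)
  qed
  show int: "integrable H (\<lambda>t. t)"
    unfolding H_def height_measure_def
    by (subst integrable_distr_eq[OF measurable_height])
      (auto intro!: finite_measure.integrable_const_bound[OF fin, of _ "\<bar>k\<bar> + R"] AE_I2 bound measurable_height
        simp: space_restrict_space)
  have refl_meas: "(\<lambda>t. 2 * k - t) \<in> measurable H borel" by (simp add: measurable_cong_sets[OF sets refl])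
  have sym: "H = distr H borel (\<lambda>t. 2 * k - t)"
  proof (rule measure_eqI)
    show "sets H = sets (distr H borel (\<lambda>t. 2 * k - t))" by (simp add: sets)
    fix X assume "X \<in> sets H"
    then have X: "X \<in> sets borel" by (simp add: sets)
    have img: "?B \<inter> {x. x \<bullet> e \<in> X} = (\<lambda>x. (- 1) *\<^sub>R x + (2 * k) *\<^sub>R e) ` (?B \<inter> {x. 2 * k - x \<bullet> e \<in> X})" (is "?L = ?T ` ?S")
    proof -
      have T: "dist (k *\<^sub>R e) (?T x) = dist (k *\<^sub>R e) x" "?T x \<bullet> e = 2 * k - x \<bullet> e" "?T (?T x) = x" for x
      proof -
        have "(2 * k) *\<^sub>R e = k *\<^sub>R e + k *\<^sub>R e" by (simp only: mult_2 scaleR_left_distrib)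
        then have "k *\<^sub>R e - ?T x = - (k *\<^sub>R e - x)" by simp
        then show "dist (k *\<^sub>R e) (?T x) = dist (k *\<^sub>R e) x"
          unfolding dist_norm by (simp only: norm_minus_cancel)
      qed (simp_all add: inner_diff_left ee)
      show ?thesis
      proof
        show "?T ` ?S \<subseteq> ?L" using T(1,2) by auto
        show "?L \<subseteq> ?T ` ?S"
        proof
          fix y assume y: "y \<in> ?L"
          have "?T y \<in> ?S" using y T(1)[of y] T(2)[of y] by simp
          then show "y \<in> ?T ` ?S" using T(3)[of y] by (metis imageI)
        qed
      qed
    qed
    have "measure H X = measure lebesgue (?B \<inter> {x. x \<bullet> e \<in> X})"
      unfolding H_def by (rule measure_height_measure[OF B X])
    also have "\<dots> = measure lebesgue (?B \<inter> {x. 2 * k - x \<bullet> e \<in> X})"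
      unfolding img by (simp only: measure_lebesgue_affine) simp
    also have "\<dots> = measure H ((\<lambda>t. 2 * k - t) -` X)"
    proof -
      have "(\<lambda>t. 2 * k - t) \<in> borel_measurable borel" by simp
      then have "(\<lambda>t. 2 * k - t) -` X \<in> sets borel" using X by (rule measurable_sets_borel)
      then show ?thesis unfolding H_def by (simp add: measure_height_measure[OF B])
    qed
    also have "\<dots> = measure (distr H borel (\<lambda>t. 2 * k - t)) X"
      using X by (subst measure_distr[OF refl_meas]) (auto simp: space)
    finally have *: "measure H X = measure (distr H borel (\<lambda>t. 2 * k - t)) X" .
    interpret D: finite_measure "distr H borel (\<lambda>t. 2 * k - t)" by (rule finite_measure_distr[OF refl_meas])
    show "emeasure H X = emeasure (distr H borel (\<lambda>t. 2 * k - t)) X"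
      by (simp add: emeasure_eq_measure D.emeasure_eq_measure *)
  qed
  have "(\<integral>t. t \<partial>H) = (\<integral>t. t \<partial>distr H borel (\<lambda>t. 2 * k - t))" by (subst sym) (rule refl)
  also have "\<dots> = (\<integral>t. 2 * k - t \<partial>H)" by (rule integral_distr[OF refl_meas]) simp
  also have "\<dots> = 2 * k * measure H (space H) - (\<integral>t. t \<partial>H)"
    using int by (subst Bochner_Integration.integral_diff) auto
  also have "measure H (space H) = measure lebesgue ?B"
    using measure_height_measure[OF B, of UNIV e] by (simp add: H_def[symmetric] space)
  also have "\<dots> = measure lebesgue (ball (0::'a) R)" using R by (simp add: content_ball)
  finally show "(\<integral>t. t \<partial>H) = k * measure lebesgue (ball (0::'a) R)" by simp
qed

text \<open>
  In every direction \<open>e\<close> the heights of \<open>A\<close> are distributed like those of a ball with centre \<open>k e *\<^sub>R e\<close>. The mean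
  height is linear in \<open>e\<close>, so the numbers \<open>k e\<close> are the heights of a single point \<open>p\<close>. A point outside
  \<open>cball p R\<close> is outside the slab of half-width \<open>R\<close> around \<open>p\<close> for all \<open>e\<close> in some open set of directions, so countably many
  slabs suffice to cut out the ball up to a null set.
\<close>
theorem Brunn_Minkowski_ball_equality:
  fixes A :: "'a::euclidean_space set"
  assumes r: "0 < r" and R: "0 < R"
    and A: "A \<in> lmeasurable" "measure lebesgue A = measure lebesgue (ball (0::'a) R)"
    and C: "A + ball 0 r \<in> lmeasurable" "measure lebesgue (A + ball 0 r) = measure lebesgue (ball (0::'a) (R + r))"
  obtains p where "negligible (A - cball p R)"
proof -
  let ?M = "restrict_space lebesgue A"
  have "\<exists>k. \<forall>s. volume_below A e s = volume_below (ball (k *\<^sub>R e) R) e s" if "norm e = 1" for e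
    by (rule equality_imp_ball_heights[OF that r R A C]) blast
  then have "\<forall>e\<in>sphere 0 1. \<exists>k. volume_below A e = volume_below (ball (k *\<^sub>R e) R) e"
    by (simp add: fun_eq_iff)
  from bchoice[OF this] obtain k
    where k: "\<And>e. norm e = 1 \<Longrightarrow> volume_below A e = volume_below (ball (k e *\<^sub>R e) R) e"
    by auto
  have H: "height_measure A e = height_measure (ball (k e *\<^sub>R e) R) e" if "norm e = 1" for e
    using k[OF that] A(1)
    by (intro cdf_unique' finite_borel_height_measure) (auto simp: cdf_height_measure)
  have posA: "0 < measure lebesgue A" using A(2) R by simp
  have mean: "integrable ?M (\<lambda>x. x \<bullet> e)" "(\<integral>x. x \<bullet> e \<partial>?M) = k e * measure lebesgue A"
    if e: "norm e = 1" for e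
  proof -
    have "integrable (height_measure A e) (\<lambda>t. t)" unfolding H[OF e] by (rule height_mean_ball[OF e R])
    then show "integrable ?M (\<lambda>x. x \<bullet> e)"
      unfolding height_measure_def by (subst (asm) integrable_distr_eq[OF measurable_height]) auto
    have "(\<integral>x. x \<bullet> e \<partial>?M) = (\<integral>t. t \<partial>height_measure A e)"
      unfolding height_measure_def by (rule integral_distr[OF measurable_height, symmetric]) simp
    also have "\<dots> = k e * measure lebesgue A"
      unfolding H[OF e] A(2) by (rule height_mean_ball[OF e R])
    finally show "(\<integral>x. x \<bullet> e \<partial>?M) = k e * measure lebesgue A" .
  qed
  define p where "p = (\<Sum>i\<in>Basis. k i *\<^sub>R i)"
  have pk: "p \<bullet> e = k e" if e: "norm e = 1" for e
  proof -
    have "k e * measure lebesgue A = (\<integral>x. (\<Sum>i\<in>Basis. (x \<bullet> i) * (e \<bullet> i)) \<partial>?M)"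
      unfolding mean(2)[OF e, symmetric] by (simp add: euclidean_inner[of _ e])
    also have "\<dots> = (\<Sum>i\<in>Basis. k i * measure lebesgue A * (e \<bullet> i))"
      by (subst Bochner_Integration.integral_sum) (auto simp: mean)
    also have "\<dots> = (p \<bullet> e) * measure lebesgue A"
      by (simp add: p_def inner_commute[of _ e] inner_sum_right sum_distrib_left sum_distrib_right mult_ac)
    finally show ?thesis using posA by simp
  qed
  have slab: "negligible (A \<inter> {x. x \<bullet> e \<le> k e - R})" if e: "norm e = 1" for e
  proof -
    have "ball (k e *\<^sub>R e) R \<inter> {x. x \<bullet> e \<le> k e - R} = {}"
    proof -
      have "k e - R < x \<bullet> e" if "x \<in> ball (k e *\<^sub>R e) R" for x
      proof -
        have "(k e *\<^sub>R e - x) \<bullet> e \<le> norm (k e *\<^sub>R e - x)"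
          using Cauchy_Schwarz_ineq2[of "k e *\<^sub>R e - x" e] e by simp
        also have "\<dots> < R" using that by (simp add: dist_norm)
        finally show ?thesis using e by (simp add: inner_diff_left norm_eq_1)
      qed
      then show ?thesis by fastforce
    qed
    then have "measure lebesgue (A \<inter> {x. x \<bullet> e \<le> k e - R}) = 0"
      using fun_cong[OF k[OF e], of "k e - R"] by (simp add: volume_below_def)
    then show ?thesis using A(1) by (simp add: negligible_iff_measure0)
  qed
  obtain D :: "'a set" where D: "countable D" "\<And>X. open X \<Longrightarrow> X \<noteq> {} \<Longrightarrow> \<exists>d\<in>D. d \<in> X"
    using countable_dense_exists by blast
  have "A - cball p R \<subseteq> (\<Union>d\<in>D - {0}. A \<inter> {x. x \<bullet> (d /\<^sub>R norm d) \<le> k (d /\<^sub>R norm d) - R})"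
  proof
    fix x assume x: "x \<in> A - cball p R"
    let ?X = "{d. (x - p) \<bullet> d + R * norm d < 0}"
    have "open ?X" by (intro open_Collect_less continuous_intros)
    moreover have "p - x \<in> ?X"
    proof -
      have n: "R < norm (p - x)" using x by (simp add: dist_norm)
      then have "R * norm (p - x) < norm (p - x) * norm (p - x)" using R by (intro mult_strict_right_mono) auto
      moreover have "(x - p) \<bullet> (p - x) = - ((p - x) \<bullet> (p - x))"
        by (metis inner_minus_left minus_diff_eq)
      then have "(x - p) \<bullet> (p - x) = - (norm (p - x) * norm (p - x))"
        by (simp add: dot_square_norm power2_eq_square)
      ultimately show ?thesis by simp
    qed
    ultimately obtain d where d: "d \<in> D" "(x - p) \<bullet> d + R * norm d < 0" using D(2)[of ?X] by blast
    have d0: "d \<noteq> 0" using d(2) by auto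
    let ?e = "d /\<^sub>R norm d"
    have e: "norm ?e = 1" using d0 by simp
    have "(x - p) \<bullet> ?e < - R" using d(2) d0 by (simp add: field_simps)
    then have "x \<bullet> ?e \<le> k ?e - R" using pk[OF e] inner_diff_left[of x p ?e] by linarith
    with x d d0 show "x \<in> (\<Union>d\<in>D - {0}. A \<inter> {x. x \<bullet> (d /\<^sub>R norm d) \<le> k (d /\<^sub>R norm d) - R})" by blast
  qed
  moreover have "negligible (\<Union>d\<in>D - {0}. A \<inter> {x. x \<bullet> (d /\<^sub>R norm d) \<le> k (d /\<^sub>R norm d) - R})"
  proof (rule negligible_countable_Union)
    show "countable ((\<lambda>d. A \<inter> {x. x \<bullet> (d /\<^sub>R norm d) \<le> k (d /\<^sub>R norm d) - R}) ` (D - {0}))"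
      using D(1) by blast
    fix X assume "X \<in> (\<lambda>d. A \<inter> {x. x \<bullet> (d /\<^sub>R norm d) \<le> k (d /\<^sub>R norm d) - R}) ` (D - {0})"
    then obtain d where d: "X = A \<inter> {x. x \<bullet> (d /\<^sub>R norm d) \<le> k (d /\<^sub>R norm d) - R}" "d \<noteq> 0"
      by blast
    show "negligible X" unfolding d(1) by (rule slab) (use d(2) in simp)
  qed
  ultimately show ?thesis by (intro that[of p]) (rule negligible_subset)
qed

section \<open>The Lebesgue density theorem\<close>

text \<open>
  Given an open \<open>U\<close> containing \<open>N\<close>, the Vitali covering theorem covers almost all of \<open>N\<close> by disjoint balls in \<open>U\<close> in
  which \<open>S\<close> has density below \<open>c\<close>; the part of \<open>S\<close> in these balls has volume at most \<open>c\<close> times that of \<open>U\<close>. So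
  \<open>N\<close> has open neighbourhoods with volumes decreasing geometrically. Since \<open>N\<close> may
  fail to be measurable, its size is controlled through these neighbourhoods.
\<close>
lemma negligible_low_density:
  fixes S N :: "'a::euclidean_space set"
  assumes S: "S \<in> sets lebesgue" and c: "0 \<le> c" "c < 1"
    and N: "N \<subseteq> S" "bounded N"
    and low: "\<And>x d. x \<in> N \<Longrightarrow> 0 < d \<Longrightarrow> \<exists>\<rho>. 0 < \<rho> \<and> \<rho> < d \<and>
                measure lebesgue (S \<inter> ball x \<rho>) < c * measure lebesgue (ball x \<rho>)"
  shows "negligible N"
proof -
  define q where "q = (1 + c) / 2"
  have q: "0 < q" "q < 1" "c < q" using c by (auto simp: q_def)
  obtain U0 where U0: "N \<subseteq> U0" "open U0" "bounded U0"
  proof -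
    obtain a where "N \<subseteq> ball 0 a" using N(2) bounded_subset_ballD by blast
    then show ?thesis by (intro that[of "ball 0 a"]) auto
  qed
  define M where "M = measure lebesgue U0 + 1"
  have M: "0 < M" by (simp add: M_def add_nonneg_pos)
  have shrink: "\<exists>U. open U \<and> N \<subseteq> U \<and> U \<in> lmeasurable \<and> measure lebesgue U \<le> q ^ k * M" for k :: nat
  proof (induction k)
    case 0
    show ?case using U0 lmeasurable_open[of U0] by (intro exI[of _ U0]) (auto simp: M_def)
  next
    case (Suc k)
    then obtain U where U: "open U" "N \<subseteq> U" "U \<in> lmeasurable" "measure lebesgue U \<le> q ^ k * M" by blast
    define K where "K = {(x, \<rho>). ball x \<rho> \<subseteq> U \<and> 0 < \<rho> \<and> measure lebesgue (S \<inter> ball x \<rho>) < c * measure lebesgue (ball x \<rho>)}"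
    have "\<exists>i. i \<in> K \<and> x \<in> ball (fst i) (snd i) \<and> snd i < d" if x: "x \<in> N" "0 < d" for x d
    proof -
      obtain \<epsilon> where \<epsilon>: "0 < \<epsilon>" "ball x \<epsilon> \<subseteq> U" using U(1,2) x by (meson openE in_mono)
      then obtain \<rho> where \<rho>: "0 < \<rho>" "\<rho> < min d \<epsilon>" "measure lebesgue (S \<inter> ball x \<rho>) < c * measure lebesgue (ball x \<rho>)"
        using low[OF x(1), of "min d \<epsilon>"] x(2) by auto
      then have "ball x \<rho> \<subseteq> U" using \<epsilon>(2) subset_ball[of \<rho> \<epsilon> x] by auto
      with \<rho> show ?thesis by (intro exI[of _ "(x, \<rho>)"]) (auto simp: K_def)
    qed
    then obtain C where C: "countable C" "C \<subseteq> K"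
        "pairwise (\<lambda>i j. disjnt (ball (fst i) (snd i)) (ball (fst j) (snd j))) C"
        "negligible (N - (\<Union>i\<in>C. ball (fst i) (snd i)))"
      using Vitali_covering_theorem_balls[of N K fst snd] by blast
    let ?B = "\<lambda>i::'a \<times> real. ball (fst i) (snd i)"
    have Ksub: "?B i \<subseteq> U" and Klow: "measure lebesgue (S \<inter> ?B i) \<le> c * measure lebesgue (?B i)" if "i \<in> C" for i
      using subsetD[OF C(2) that] unfolding K_def by (cases i; simp)+
    have SB: "S \<inter> ?B i \<in> lmeasurable" for i
      using fmeasurable_Int_fmeasurable[OF lmeasurable_ball S] by (simp add: Int_commute)
    have leU: "measure lebesgue (\<Union>i\<in>F. S \<inter> ?B i) \<le> c * measure lebesgue U" if F: "finite F" "F \<subseteq> C" for F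
    proof -
      have "measure lebesgue (\<Union>i\<in>F. S \<inter> ?B i) \<le> (\<Sum>i\<in>F. measure lebesgue (S \<inter> ?B i))"
        using F SB by (intro measure_UNION_le) (auto dest: fmeasurableD)
      also have "\<dots> \<le> (\<Sum>i\<in>F. c * measure lebesgue (?B i))"
        using F Klow by (intro sum_mono) auto
      also have "\<dots> = c * (\<Sum>i\<in>F. measure lebesgue (?B i))" by (simp add: sum_distrib_left)
      also have "(\<Sum>i\<in>F. measure lebesgue (?B i)) = measure lebesgue (\<Union>i\<in>F. ?B i)"
        using F pairwise_subset[OF C(3)] by (intro measure_UNION'[symmetric]) auto
      also have "c * \<dots> \<le> c * measure lebesgue U"
        using F Ksub U(3) c by (intro mult_left_mono measure_mono_fmeasurable) auto
      finally show ?thesis .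
    qed
    define V where "V = (\<Union>i\<in>C. S \<inter> ?B i)"
    have V: "V \<in> lmeasurable" "measure lebesgue V \<le> c * measure lebesgue U"
      unfolding V_def by (rule fmeasurable_UN_bound[OF C(1) SB leU] measure_UN_bound[OF C(1) SB leU]; assumption)+
    define W where "W = V \<union> (N - (\<Union>i\<in>C. ?B i))"
    have W: "W \<in> lmeasurable" "measure lebesgue W \<le> c * measure lebesgue U" "N \<subseteq> W"
    proof -
      have W': "measure lebesgue W = measure lebesgue V" "W \<in> lmeasurable"
        unfolding W_def using V(1) C(4)
        by (auto intro: measure_Un_null_set fmeasurable.Un negligible_imp_measurable simp: negligible_iff_null_sets[symmetric])
      then show "W \<in> lmeasurable" "measure lebesgue W \<le> c * measure lebesgue U" using V by auto
      show "N \<subseteq> W" using N(1) by (auto simp: W_def V_def)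
    qed
    have pos: "0 < (q - c) * (q ^ k * M)" using q M by simp
    obtain T where T: "open T" "W \<subseteq> T" "T \<in> lmeasurable" "measure lebesgue T < measure lebesgue W + (q - c) * (q ^ k * M)"
    proof -
      obtain T where T: "open T" "W \<subseteq> T" "T - W \<in> lmeasurable" "emeasure lebesgue (T - W) < ennreal ((q - c) * (q ^ k * M))"
        using sets_lebesgue_outer_open[OF fmeasurableD[OF W(1)] pos] by blast
      have eq: "T = W \<union> (T - W)" using T(2) by auto
      have "T \<in> lmeasurable" by (subst eq) (intro fmeasurable.Un W(1) T(3))
      moreover have "measure lebesgue T \<le> measure lebesgue W + measure lebesgue (T - W)"
        by (subst eq) (intro measure_Un_le fmeasurableD W(1) T(3))
      moreover have "measure lebesgue (T - W) < (q - c) * (q ^ k * M)"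
        using T(4) pos by (simp add: emeasure_eq_measure2[OF T(3)] ennreal_less_iff)
      ultimately show ?thesis using T(1,2) by (intro that) auto
    qed
    have "measure lebesgue T \<le> c * (q ^ k * M) + (q - c) * (q ^ k * M)"
      using T(4) W(2) mult_left_mono[OF U(4) c(1)] by linarith
    also have "\<dots> = q ^ Suc k * M" by (simp add: algebra_simps)
    finally show ?case using T W(3) by blast
  qed
  show ?thesis
    unfolding negligible_outer_le
  proof (intro allI impI)
    fix e :: real assume "0 < e"
    then obtain k where "q ^ k < e / M" using q M real_arch_pow_inv[of "e / M" q] by auto
    then have "q ^ k * M \<le> e" using M by (simp add: field_simps)
    then show "\<exists>T. N \<subseteq> T \<and> T \<in> lmeasurable \<and> measure lebesgue T \<le> e"
      using shrink[of k] by (meson order_trans)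
  qed
qed

lemma negligible_not_density_one:
  fixes S :: "(real^'n) set"
  assumes S: "S \<in> sets lebesgue"
  shows "negligible (S - density_one_points S)"
proof -
  define N where "N k j = {x \<in> S \<inter> ball 0 (real j). \<forall>d>0. \<exists>\<rho>. 0 < \<rho> \<and> \<rho> < d \<and>
      measure lebesgue (S \<inter> ball x \<rho>) < (1 - 1 / real (Suc k)) * measure lebesgue (ball x \<rho>)}" for k j :: nat
  have "negligible (N k j)" for k j
  proof (rule negligible_low_density[OF S, of "1 - 1 / real (Suc k)"])
    show "bounded (N k j)" by (rule bounded_subset[of "ball 0 (real j)"]) (auto simp: N_def)
  qed (auto simp: N_def)
  then have "negligible (\<Union>k. \<Union>j. N k j)" by (intro negligible_Union_nat)
  moreover have "S - density_one_points S \<subseteq> (\<Union>k. \<Union>j. N k j)"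
  proof
    fix x assume x: "x \<in> S - density_one_points S"
    let ?f = "\<lambda>\<rho>. measure lebesgue (S \<inter> ball x \<rho>) / measure lebesgue (ball x \<rho>)"
    have le1: "?f \<rho> \<le> 1" if "0 < \<rho>" for \<rho>
    proof -
      have "measure lebesgue (S \<inter> ball x \<rho>) \<le> measure lebesgue (ball x \<rho>)"
        using S by (intro measure_mono_fmeasurable) auto
      then show ?thesis using that by (simp add: divide_simps)
    qed
    have "\<not> (?f \<longlongrightarrow> 1) (at_right 0)" using x by (simp add: density_one_points_def)
    then obtain \<epsilon> where \<epsilon>: "0 < \<epsilon>" "\<not> (\<forall>\<^sub>F \<rho> in at_right 0. dist (?f \<rho>) 1 < \<epsilon>)"
      unfolding tendsto_iff by blast
    obtain k where k: "1 / real (Suc k) < \<epsilon>" using nat_approx_posE[OF \<epsilon>(1)] by blast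
    obtain j :: nat where j: "norm x < real j" using reals_Archimedean2 by blast
    have "\<exists>\<rho>. 0 < \<rho> \<and> \<rho> < d \<and> measure lebesgue (S \<inter> ball x \<rho>) < (1 - 1 / real (Suc k)) * measure lebesgue (ball x \<rho>)"
      if d: "0 < d" for d
    proof -
      obtain \<rho> where \<rho>: "0 < \<rho>" "\<rho> < d" "\<not> dist (?f \<rho>) 1 < \<epsilon>"
        using \<epsilon>(2) d unfolding eventually_at_right_field by auto
      then have "?f \<rho> < 1 - 1 / real (Suc k)"
        using le1[OF \<rho>(1)] k unfolding dist_real_def by linarith
      then show ?thesis using \<rho> by (auto simp: pos_divide_less_eq)
    qed
    then have "x \<in> N k j" using x j by (auto simp: N_def)
    then show "x \<in> (\<Union>k. \<Union>j. N k j)" by blast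
  qed
  ultimately show ?thesis by (rule negligible_subset)
qed

lemma density_one_points_Compl:
  fixes S :: "(real^'n) set"
  assumes S: "S \<in> sets lebesgue"
  shows "density_one_points S \<inter> density_one_points (- S) = {}"
proof (rule ccontr)
  assume "density_one_points S \<inter> density_one_points (- S) \<noteq> {}"
  then obtain x where x: "x \<in> density_one_points S" "x \<in> density_one_points (- S)" by blast
  let ?f = "\<lambda>S \<rho>. measure lebesgue (S \<inter> ball x \<rho>) / measure lebesgue (ball x \<rho>)"
  have "((\<lambda>\<rho>. ?f S \<rho> + ?f (- S) \<rho>) \<longlongrightarrow> 1 + 1) (at_right 0)"
    using x by (intro tendsto_add) (simp_all add: density_one_points_def)
  moreover have "\<forall>\<^sub>F \<rho> in at_right 0. ?f S \<rho> + ?f (- S) \<rho> = 1"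
    using eventually_at_right_less[of "0::real"]
  proof eventually_elim
    case (elim \<rho>)
    have SB: "S \<inter> ball x \<rho> \<in> lmeasurable"
      using fmeasurable_Int_fmeasurable[OF lmeasurable_ball S] by (simp add: Int_commute)
    have "- S \<inter> ball x \<rho> = ball x \<rho> - S \<inter> ball x \<rho>" by auto
    then have "measure lebesgue (- S \<inter> ball x \<rho>) = measure lebesgue (ball x \<rho>) - measure lebesgue (S \<inter> ball x \<rho>)"
      using SB by (simp only:) (intro measurable_measure_Diff, auto)
    then show ?case using elim by (simp add: add_divide_distrib[symmetric])
  qed
  ultimately have "((\<lambda>\<rho>. 1) \<longlongrightarrow> (1 + 1 :: real)) (at_right (0::real))"
    by (rule Lim_transform_eventually)
  then show False by (simp add: tendsto_const_iff)
qed

lemma density_one_points_ae_eq: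
  fixes S :: "(real^'n) set"
  assumes S: "S \<in> sets lebesgue"
  shows "negligible (sym_diff S (density_one_points S))"
proof -
  have S': "- S \<in> sets lebesgue" using S by (simp add: Compl_in_sets_lebesgue)
  have "density_one_points S - S \<subseteq> - S - density_one_points (- S)"
    using density_one_points_Compl[OF S] by blast
  then have "negligible (density_one_points S - S)"
    by (rule negligible_subset[OF negligible_not_density_one[OF S']])
  then show ?thesis using negligible_not_density_one[OF S] by simp
qed

lemma open_subset_density_one_points:
  fixes U :: "(real^'n) set"
  assumes "open U" "U \<subseteq> S"
  shows "U \<subseteq> density_one_points S"
proof
  fix x assume "x \<in> U"
  then obtain e where e: "0 < e" "ball x e \<subseteq> U" using assms(1) openE by blast
  have "\<forall>\<^sub>F \<rho> in at_right 0. 1 = measure lebesgue (S \<inter> ball x \<rho>) / measure lebesgue (ball x \<rho>)"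
    using eventually_at_right_real[OF e(1)]
  proof eventually_elim
    case (elim \<rho>)
    then have "S \<inter> ball x \<rho> = ball x \<rho>" using e(2) assms(2) subset_ball[of \<rho> e x] by auto
    then show ?case using elim by simp
  qed
  then have "((\<lambda>\<rho>. measure lebesgue (S \<inter> ball x \<rho>) / measure lebesgue (ball x \<rho>)) \<longlongrightarrow> 1) (at_right 0)"
    by (rule Lim_transform_eventually[OF tendsto_const])
  then show "x \<in> density_one_points S" by (simp add: density_one_points_def)
qed

text \<open>
  The set of density-one points lies between the open and the closed ball, which have the same interior
  and the same closure.
\<close>
lemma frontier_density_one_points_ball:
  fixes c :: "real^'n"
  assumes R: "0 < R"
  shows "frontier (density_one_points (ball c R)) = frontier (ball c R)"
proof -
  let ?F = "density_one_points (ball c R)"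
  have sub: "ball c R \<subseteq> ?F" by (rule open_subset_density_one_points) auto
  have "- cball c R \<subseteq> density_one_points (- ball c R)"
    by (rule open_subset_density_one_points) auto
  then have sup: "?F \<subseteq> cball c R" using density_one_points_Compl[of "ball c R"] by auto
  have "closure ?F = cball c R"
    using closure_mono[OF sub] closure_mono[OF sup] R by auto
  moreover have "interior ?F = ball c R"
    using interior_mono[OF sub] interior_mono[OF sup] by auto
  ultimately show ?thesis using R by (simp add: frontier_def)
qed

section \<open>Isoperimetric inequality for enlarged frontiers\<close>

text \<open>
  The ball around \<open>z\<close> is connected, so it meets the frontier of \<open>F\<close> as soon as it meets \<open>F\<close> and its
  complement; it is open, so the converse holds as well.
\<close>
lemma frontier_enlargement:
  fixes F :: "'a::euclidean_space set"
  shows "(\<Union>x\<in>frontier F. ball x r) = (F + ball 0 r) - {x. ball x r \<subseteq> F}"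
proof (rule set_eqI)
  fix z
  have plus: "z \<in> F + ball 0 r \<longleftrightarrow> ball z r \<inter> F \<noteq> {}"
    unfolding set_plus_ball by (force simp: dist_commute)
  have "z \<in> (\<Union>x\<in>frontier F. ball x r) \<longleftrightarrow> ball z r \<inter> frontier F \<noteq> {}"
    by (force simp: dist_commute)
  also have "\<dots> \<longleftrightarrow> ball z r \<inter> F \<noteq> {} \<and> ball z r - F \<noteq> {}"
  proof
    assume "ball z r \<inter> F \<noteq> {} \<and> ball z r - F \<noteq> {}"
    then show "ball z r \<inter> frontier F \<noteq> {}"
      using connected_Int_frontier[of "ball z r" F] by auto
  next
    assume "ball z r \<inter> frontier F \<noteq> {}"
    then obtain x where x: "x \<in> ball z r" "x \<in> frontier F" by auto
    then obtain e where e: "0 < e" "ball x e \<subseteq> ball z r" using openE[OF open_ball] by blast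
    from x(2) e(1) have "(\<exists>y\<in>F. dist x y < e) \<and> (\<exists>y. y \<notin> F \<and> dist x y < e)"
      unfolding frontier_straddle by blast
    then show "ball z r \<inter> F \<noteq> {} \<and> ball z r - F \<noteq> {}" using e(2) by fastforce
  qed
  finally show "z \<in> (\<Union>x\<in>frontier F. ball x r) \<longleftrightarrow> z \<in> (F + ball 0 r) - {x. ball x r \<subseteq> F}"
    using plus by auto
qed

lemma closed_inner_parallel: "closed {x::'a::euclidean_space. ball x r \<subseteq> F}"
proof -
  have "- {x. ball x r \<subseteq> F} = (\<Union>y\<in>- F. ball y r)" by (auto simp: dist_commute)
  then show ?thesis by (simp add: closed_def open_UN)
qed

lemma lmeasurable_inner_parallel:
  fixes F :: "'a::euclidean_space set"
  assumes "F \<in> lmeasurable" "0 < r"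
  shows "{x. ball x r \<subseteq> F} \<in> lmeasurable" "{x. ball x r \<subseteq> F} \<subseteq> F"
proof -
  show sub: "{x. ball x r \<subseteq> F} \<subseteq> F" using assms(2) centre_in_ball by blast
  show "{x. ball x r \<subseteq> F} \<in> lmeasurable"
    by (rule fmeasurableI2[OF assms(1) sub] sets_completionI_sets)+
      (simp add: borel_closed closed_inner_parallel)
qed

lemma ball_plus_ball:
  assumes "0 < R" "0 < r"
  shows "ball (0::'a::euclidean_space) R + ball 0 r = ball 0 (R + r)"
proof
  show "ball (0::'a) R + ball 0 r \<subseteq> ball 0 (R + r)"
    by (auto simp: set_plus_def intro!: norm_triangle_lt add_strict_mono)
  show "ball (0::'a) (R + r) \<subseteq> ball 0 R + ball 0 r"
  proof
    fix x :: 'a assume x: "x \<in> ball 0 (R + r)"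
    have "(R / (R + r)) *\<^sub>R x \<in> ball 0 R" "(r / (R + r)) *\<^sub>R x \<in> ball 0 r"
      using x assms by (auto simp: pos_divide_less_eq)
    moreover have "x = (R / (R + r)) *\<^sub>R x + (r / (R + r)) *\<^sub>R x"
      using assms by (simp add: scaleR_add_left[symmetric] add_divide_distrib[symmetric])
    ultimately show "x \<in> ball 0 R + ball 0 r" by (metis set_plus_intro)
  qed
qed

lemma measure_plus_ball_ge:
  fixes A :: "'a::euclidean_space set"
  assumes A: "A \<in> lmeasurable" "A \<noteq> {}" and C: "A + ball 0 r \<in> lmeasurable" and r: "0 < r" and R: "0 \<le> R"
    and vol: "measure lebesgue (ball (0::'a) R) \<le> measure lebesgue A"
  shows "measure lebesgue (ball (0::'a) (R + r)) \<le> measure lebesgue (A + ball 0 r)"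
proof -
  let ?n = "DIM('a)"
  define w where "w = root ?n (unit_ball_vol ?n)"
  have rt: "root ?n (measure lebesgue (ball (0::'a) \<rho>)) = w * \<rho>" if "0 \<le> \<rho>" for \<rho>
    using that by (simp add: content_ball w_def real_root_mult real_root_power_cancel)
  have "w * R \<le> root ?n (measure lebesgue A)"
    using real_root_le_mono[OF DIM_positive[where 'a='a] vol] unfolding rt[OF R] .
  then have "w * (R + r) \<le> root ?n (measure lebesgue A) + root ?n (measure lebesgue (ball (0::'a) r))"
    using rt[OF less_imp_le[OF r]] unfolding distrib_left by linarith
  moreover have "0 \<le> w * (R + r)" using R r by (simp add: w_def)
  ultimately have "(w * (R + r)) ^ ?n \<le> (root ?n (measure lebesgue A) + root ?n (measure lebesgue (ball (0::'a) r))) ^ ?n"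
    by (rule power_mono)
  also have "\<dots> \<le> measure lebesgue (A + ball 0 r)"
    using A C r by (intro Brunn_Minkowski) auto
  also have "(w * (R + r)) ^ ?n = measure lebesgue (ball (0::'a) (R + r))"
    using R r rt[of "R + r"] by (metis DIM_positive add_nonneg_nonneg less_imp_le measure_nonneg real_root_pow_pos2)
  finally show ?thesis .
qed

text \<open>
  The inner parallel set \<open>I\<close> satisfies \<open>I + ball 0 r \<subseteq> F\<close>, so the Brunn-Minkowski inequality gives
  \<open>root n (measure I) \<le> w * (R - r)\<close>, where \<open>w\<close> is the root of the volume of the unit ball. This also
  shows that \<open>I\<close> is null when \<open>R < r\<close>.
\<close>
lemma measure_inner_parallel_le:
  fixes F :: "'a::euclidean_space set"
  assumes F: "F \<in> lmeasurable" "measure lebesgue F = measure lebesgue (ball (0::'a) R)" and r: "0 < r" and R: "0 < R"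
  shows "measure lebesgue {x. ball x r \<subseteq> F} \<le> measure lebesgue {x::'a. ball x r \<subseteq> ball 0 R}"
proof (cases "measure lebesgue {x. ball x r \<subseteq> F} = 0")
  case False
  let ?n = "DIM('a)" and ?I = "{x. ball x r \<subseteq> F}"
  define w where "w = root ?n (unit_ball_vol ?n)"
  have w: "0 < w" by (simp add: w_def)
  have rt: "root ?n (measure lebesgue (ball (0::'a) \<rho>)) = w * \<rho>" if "0 \<le> \<rho>" for \<rho>
    using that by (simp add: content_ball w_def real_root_mult real_root_power_cancel)
  have ne: "?I \<noteq> {}" using False by (metis measure_empty)
  have sub: "?I + ball 0 r \<subseteq> F" unfolding set_plus_ball by auto
  have C: "?I + ball 0 r \<in> lmeasurable"
    by (rule open_subset_lmeasurable[OF F(1) open_set_plus[OF open_ball] sub])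
  have "(root ?n (measure lebesgue ?I) + root ?n (measure lebesgue (ball (0::'a) r))) ^ ?n \<le> measure lebesgue (?I + ball 0 r)"
    using lmeasurable_inner_parallel[OF F(1) r] ne C r by (intro Brunn_Minkowski) auto
  also have "\<dots> \<le> measure lebesgue F"
    using sub C F by (intro measure_mono_fmeasurable) auto
  also have "\<dots> = root ?n (measure lebesgue (ball (0::'a) R)) ^ ?n" by (simp add: F)
  finally have "root ?n (measure lebesgue ?I) + root ?n (measure lebesgue (ball (0::'a) r)) \<le> root ?n (measure lebesgue (ball (0::'a) R))"
    by (rule power_le_imp_le_base[where n = "?n - 1", simplified]) simp
  then have le: "root ?n (measure lebesgue ?I) \<le> w * (R - r)"
    using r R rt[of r] rt[of R] by (simp add: algebra_simps)
  then have "0 \<le> w * (R - r)" by (rule order_trans[rotated]) simp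
  then have Rr: "0 \<le> R - r" using w by (simp add: zero_le_mult_iff)
  have "measure lebesgue ?I = root ?n (measure lebesgue ?I) ^ ?n" by simp
  also have "\<dots> \<le> root ?n (measure lebesgue (ball (0::'a) (R - r))) ^ ?n"
    unfolding rt[OF Rr] using le by (intro power_mono) auto
  also have "\<dots> = measure lebesgue (ball (0::'a) (R - r))" by simp
  also have "\<dots> \<le> measure lebesgue {x::'a. ball x r \<subseteq> ball 0 R}"
  proof (rule measure_mono_fmeasurable)
    show "ball 0 (R - r) \<subseteq> {x::'a. ball x r \<subseteq> ball 0 R}"
    proof (clarsimp)
      fix x y :: 'a assume "norm x < R - r" "dist x y < r"
      then show "norm y < R" using norm_triangle_sub[of y x] by (simp add: dist_norm norm_minus_commute)
    qed
  qed (use lmeasurable_inner_parallel[OF lmeasurable_ball r] in auto)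
  finally show ?thesis .
qed simp

lemma emeasure_frontier_enlargement:
  fixes F :: "'a::euclidean_space set"
  assumes F: "F \<in> lmeasurable" and r: "0 < r"
  shows "emeasure lebesgue (\<Union>x\<in>frontier F. ball x r) =
    emeasure lebesgue (F + ball 0 r) - ennreal (measure lebesgue {x. ball x r \<subseteq> F})"
proof -
  have sub: "{x. ball x r \<subseteq> F} \<subseteq> F" "F \<subseteq> F + ball 0 r"
    using lmeasurable_inner_parallel(2)[OF F r] r unfolding set_plus_ball by force+
  note I = lmeasurable_inner_parallel(1)[OF F r]
  have "open (F + ball 0 r)" by (rule open_set_plus) simp
  then show ?thesis
    unfolding frontier_enlargement using I sub
    by (subst emeasure_Diff) (auto simp: emeasure_eq_measure2[OF I] dest: fmeasurableD)
qed

text \<open>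
  For \<open>ball 0 R\<close> the outer parallel set has the least and the inner parallel set the greatest possible volume.
  Since all volumes are finite in the equality case, equality of the differences forces equality in both.
\<close>
theorem frontier_enlargement_isoperimetric:
  fixes F :: "'a::euclidean_space set"
  assumes r: "0 < r" and R: "0 < R"
    and F: "F \<in> lmeasurable" "measure lebesgue F = measure lebesgue (ball (0::'a) R)"
  shows "emeasure lebesgue (\<Union>x\<in>frontier (ball (0::'a) R). ball x r) \<le> emeasure lebesgue (\<Union>x\<in>frontier F. ball x r)"
    and "emeasure lebesgue (\<Union>x\<in>frontier F. ball x r) = emeasure lebesgue (\<Union>x\<in>frontier (ball (0::'a) R). ball x r)
      \<Longrightarrow> \<exists>p. negligible (F - cball p R)"
proof -
  let ?\<mu> = "measure lebesgue" and ?I = "\<lambda>F::'a set. {x. ball x r \<subseteq> F}" and ?C = "F + ball 0 r"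
  have "F \<noteq> {}" using F(2) R by auto
  have opC: "open ?C" by (rule open_set_plus) simp
  have ball: "emeasure lebesgue (\<Union>x\<in>frontier (ball (0::'a) R). ball x r) = ennreal (?\<mu> (ball (0::'a) (R + r)) - ?\<mu> (?I (ball 0 R)))"
    unfolding emeasure_frontier_enlargement[OF lmeasurable_ball r] ball_plus_ball[OF R r]
    by (simp add: emeasure_eq_measure2 ennreal_minus)
  have I: "?\<mu> (?I F) \<le> ?\<mu> (?I (ball 0 R))" by (rule measure_inner_parallel_le[OF F r R])
  have inf: "emeasure lebesgue (\<Union>x\<in>frontier F. ball x r) = \<infinity>" if "?C \<notin> lmeasurable"
  proof -
    have "emeasure lebesgue ?C = \<infinity>" using that opC by (auto simp: fmeasurable_def top.not_eq_extremum[symmetric])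
    then show ?thesis unfolding emeasure_frontier_enlargement[OF F(1) r] by simp
  qed
  have fin: "emeasure lebesgue (\<Union>x\<in>frontier F. ball x r) = ennreal (?\<mu> ?C - ?\<mu> (?I F))"
     "?\<mu> (ball (0::'a) (R + r)) \<le> ?\<mu> ?C" if C: "?C \<in> lmeasurable"
  proof -
    show "emeasure lebesgue (\<Union>x\<in>frontier F. ball x r) = ennreal (?\<mu> ?C - ?\<mu> (?I F))"
      unfolding emeasure_frontier_enlargement[OF F(1) r] by (simp add: emeasure_eq_measure2[OF C] ennreal_minus)
    show "?\<mu> (ball (0::'a) (R + r)) \<le> ?\<mu> ?C"
      using F R r C \<open>F \<noteq> {}\<close> by (intro measure_plus_ball_ge) auto
  qed
  show "emeasure lebesgue (\<Union>x\<in>frontier (ball (0::'a) R). ball x r) \<le> emeasure lebesgue (\<Union>x\<in>frontier F. ball x r)"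
  proof (cases "?C \<in> lmeasurable")
    case True
    show ?thesis unfolding ball fin(1)[OF True] using fin(2)[OF True] I by (intro ennreal_leI) linarith
  qed (simp add: inf)
  assume eq: "emeasure lebesgue (\<Union>x\<in>frontier F. ball x r) = emeasure lebesgue (\<Union>x\<in>frontier (ball (0::'a) R). ball x r)"
  have C: "?C \<in> lmeasurable" using inf eq unfolding ball by (metis ennreal_neq_top infinity_ennreal_def)
  have IR: "?\<mu> (?I (ball 0 R)) \<le> ?\<mu> (ball (0::'a) (R + r))"
  proof (rule measure_mono_fmeasurable)
    show "?I (ball 0 R) \<subseteq> ball 0 (R + r)"
      using lmeasurable_inner_parallel(2)[OF lmeasurable_ball r, of 0 R] r by (rule_tac order_trans) auto
  qed (use lmeasurable_inner_parallel(1)[OF lmeasurable_ball r] in auto)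
  have "?\<mu> ?C - ?\<mu> (?I F) = ?\<mu> (ball (0::'a) (R + r)) - ?\<mu> (?I (ball 0 R))"
    using eq fin(2)[OF C] I IR unfolding ball fin(1)[OF C] by (subst (asm) ennreal_inj) auto
  then have "?\<mu> ?C = ?\<mu> (ball (0::'a) (R + r))" using fin(2)[OF C] I by linarith
  then show "\<exists>p. negligible (F - cball p R)"
    using Brunn_Minkowski_ball_equality[OF r R F C] by metis
qed

theorem lemma1p12:
  fixes r :: real
  assumes "r > 0"
  shows "(\<forall>R > 0. \<forall>E :: (real^'n) set.
            E \<in> sets lebesgue \<and> emeasure lebesgue E = emeasure lebesgue (ball (0 :: real^'n) R)
            \<longrightarrow> Per r E \<ge> Per r (ball (0 :: real^'n) R)) \<and>
         (\<forall>R > 0. \<forall>E :: (real^'n) set.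
            E \<in> sets lebesgue \<and> emeasure lebesgue E = emeasure lebesgue (ball (0 :: real^'n) R)
            \<and> Per r E = Per r (ball (0 :: real^'n) R)
            \<longrightarrow> (\<exists>p N. N \<in> null_sets lebesgue \<and> ae_eq_set E (ball p R - N)))"
proof -
  have repr: "density_one_points E \<in> lmeasurable"
      "measure lebesgue (density_one_points E) = measure lebesgue (ball (0 :: real^'n) R)"
    if E: "E \<in> sets lebesgue" "emeasure lebesgue E = emeasure lebesgue (ball (0 :: real^'n) R)"
    for E :: "(real^'n) set" and R
  proof -
    have Em: "E \<in> lmeasurable" using E fmeasurableD2[OF lmeasurable_ball, of "0::real^'n" R]
      by (auto simp: fmeasurable_def top.not_eq_extremum)
    have neg: "negligible (sym_diff E (density_one_points E))" by (rule density_one_points_ae_eq[OF E(1)])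
    show "density_one_points E \<in> lmeasurable"
      by (rule lmeasurable_negligible_symdiff[OF Em neg])
    show "measure lebesgue (density_one_points E) = measure lebesgue (ball (0 :: real^'n) R)"
      using measure_negligible_symdiff[OF Em neg] E(2) by (simp add: measure_def)
  qed
  have Per_ball: "Per r (ball (0 :: real^'n) R)
      = ennreal (1 / (2 * r)) * emeasure lebesgue (\<Union>x\<in>frontier (ball (0 :: real^'n) R). ball x r)" if "0 < R" for R
    by (simp add: Per_def ball_enlargement_def frontier_density_one_points_ball[OF that])
  show ?thesis
  proof (intro conjI allI impI)
    fix R and E :: "(real^'n) set" assume R: "0 < R"
      and "E \<in> sets lebesgue \<and> emeasure lebesgue E = emeasure lebesgue (ball (0 :: real^'n) R)"
    then have E: "E \<in> sets lebesgue" "emeasure lebesgue E = emeasure lebesgue (ball (0 :: real^'n) R)" by auto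
    show "Per r E \<ge> Per r (ball (0 :: real^'n) R)"
      unfolding Per_ball[OF R] unfolding Per_def ball_enlargement_def
      by (intro mult_left_mono frontier_enlargement_isoperimetric(1)[OF assms R repr[OF E]]) simp
  next
    fix R and E :: "(real^'n) set" assume R: "0 < R"
      and "E \<in> sets lebesgue \<and> emeasure lebesgue E = emeasure lebesgue (ball (0 :: real^'n) R)
            \<and> Per r E = Per r (ball (0 :: real^'n) R)"
    then have E: "E \<in> sets lebesgue" "emeasure lebesgue E = emeasure lebesgue (ball (0 :: real^'n) R)"
      and P: "Per r E = Per r (ball (0 :: real^'n) R)" by auto
    let ?F = "density_one_points E"
    have "ennreal (1 / (2 * r)) \<noteq> 0" using assms by simp
    then have "emeasure lebesgue (\<Union>x\<in>frontier ?F. ball x r)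
        = emeasure lebesgue (\<Union>x\<in>frontier (ball (0 :: real^'n) R). ball x r)"
      using P unfolding Per_ball[OF R] unfolding Per_def ball_enlargement_def
      by (simp add: ennreal_mult_cancel_left)
    then obtain p where p: "negligible (?F - cball p R)"
      using frontier_enlargement_isoperimetric(2)[OF assms R repr[OF E]] by blast
    have "measure lebesgue (cball p R - ?F \<inter> cball p R) = measure lebesgue (cball p R) - measure lebesgue (?F \<inter> cball p R)"
      using repr(1)[OF E] by (intro measurable_measure_Diff) auto
    also have "measure lebesgue (?F \<inter> cball p R) = measure lebesgue ?F"
    proof (rule measure_negligible_symdiff[OF repr(1)[OF E]])
      have "?F - ?F \<inter> cball p R \<union> (?F \<inter> cball p R - ?F) = ?F - cball p R" by auto
      then show "negligible (?F - ?F \<inter> cball p R \<union> (?F \<inter> cball p R - ?F))" using p by simp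
    qed
    also have "measure lebesgue (cball p R) - measure lebesgue ?F = 0"
      using R by (simp add: repr(2)[OF E] content_ball content_cball)
    finally have q: "negligible (cball p R - ?F \<inter> cball p R)"
      using fmeasurable.Diff[OF lmeasurable_cball, of "?F \<inter> cball p R" p R] repr(1)[OF E]
      by (simp add: negligible_iff_measure fmeasurable.Int)
    have "negligible (sym_diff E ?F \<union> (?F - cball p R) \<union> (cball p R - ?F \<inter> cball p R) \<union> sphere p R)"
      by (intro negligible_Un density_one_points_ae_eq[OF E(1)] p q negligible_sphere)
    then have "negligible (sym_diff E (ball p R - {}))"
      by (rule negligible_subset) (auto simp: sphere_def)
    then show "\<exists>p N. N \<in> null_sets lebesgue \<and> ae_eq_set E (ball p R - N)"
      unfolding ae_eq_set_def negligible_iff_null_sets[symmetric] by (intro exI[of _ p] exI[of _ "{}"]) simp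
  qed
qed

end
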